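(* The probability that a uniformly random sorting network of size $n$ is geometrically realizable tends to $0$ as $n\to\infty$.
   Context: Let $S_n$ be the group of permutations $\sigma=(\sigma(1),\dots,\sigma(n))$ of $\{1,\dots,n\}$ with composition $(\sigma\tau)(i)=\sigma(\tau(i))$, and let $\sigma_j$ denote the adjacent transposition (swap) $(j\ \, j+1)$. A sorting network of size $n$ is a sequence $(s_1,\dots,s_N)$ of $N:=\binom n2$ integers with $0<s_k<n$ such that $\sigma_{s_1}\sigma_{s_2}\cdots\sigma_{s_N}$ equals the reverse permutation $(n,n-1,\dots,1)$; $s_k$ is the position of the swap made at time $k$. A uniformly random sorting network of size $n$ is one chosen uniformly from the finite set of all sorting networks of size $n$. Consider a set $X$ of $n$ points in $\mathbb R^2$ such that no two points of $X$ lie on the same vertical line, no three points of $X$ are collinear, and no two pairs of points of $X$ define parallel lines. Label the points $1,\dots,n$ from left to right (in order of their first coordinate). Let $X_\phi$ be the set obtained by rotating $\mathbb R^2$ by angle $\phi$ about the origin, and let $\sigma_\phi$ be the permutation found by reading the labels in $X_\phi$ from left to right. As $\phi$ increases from $0$ to $\pi$, the permutation $\sigma_\phi$ changes via a sequence of swaps of labels in adjacent positions, whose successive positions form a sorting network of size $n$. A sorting network is geometrically realizable if it can be generated in this way from some such $X$. *)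

theory Defs
  imports "HOL-Probability.Probability" "HOL-Combinatorics.Transposition"
begin

section \<open>Sorting networks\<close>

text \<open>The matrix transpose of HOL-Analysis shares its name with the transposition of two points,
  hence the qualified name.\<close>

definition adj_swap :: "nat \<Rightarrow> nat \<Rightarrow> nat" where
  "adj_swap j = Transposition.transpose j (j + 1)"

definition swap_product :: "nat list \<Rightarrow> nat \<Rightarrow> nat" where
  "swap_product s = foldr (\<lambda>j \<pi>. adj_swap j \<circ> \<pi>) s id"

definition sorting_networks :: "nat \<Rightarrow> nat list set" where
  "sorting_networks n =
     {s. length s = n choose 2 \<and> (\<forall>j\<in>set s. 0 < j \<and> j < n) \<and>
         (\<forall>i\<in>{1..n}. swap_product s i = n + 1 - i)}"

text \<open>The next two facts make \<^const>\<open>pmf_of_set\<close> of this set the genuine uniform distribution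
  (it is unspecified on empty and on infinite sets).\<close>

lemma finite_sorting_networks: "finite (sorting_networks n)"
proof (rule finite_subset)
  show "sorting_networks n \<subseteq> {s. set s \<subseteq> {..<n} \<and> length s = n choose 2}"
    by (auto simp: sorting_networks_def)
qed (rule finite_lists_length_eq, simp)

lemma swap_product_append: "swap_product (s @ t) = swap_product s \<circ> swap_product t"
  by (induction s) (simp_all add: swap_product_def comp_assoc)

lemma swap_product_fixes: "\<forall>j\<in>set s. j + 1 < i \<Longrightarrow> swap_product s i = i"
  by (induction s) (auto simp: swap_product_def adj_swap_def Transposition.transpose_def)

lemma swap_product_rev_upt:
  "swap_product (rev [1..<Suc n]) i =
     (if i = 0 \<or> i > n + 1 then i else if i = 1 then n + 1 else i - 1)"
proof (induction n arbitrary: i)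
  case 0
  then show ?case by (auto simp: swap_product_def)
next
  case (Suc n)
  have "swap_product (rev [1..<Suc (Suc n)]) i = adj_swap (Suc n) (swap_product (rev [1..<Suc n]) i)"
    by (simp add: swap_product_def)
  then show ?case
    unfolding Suc.IH by (auto simp: adj_swap_def Transposition.transpose_def)
qed

lemma sorting_networks_nonempty: "sorting_networks n \<noteq> {}"
proof (induction n)
  case 0
  have "[] \<in> sorting_networks 0" by (simp add: sorting_networks_def)
  then show ?case by blast
next
  case (Suc n)
  then obtain s where s: "s \<in> sorting_networks n" by blast
  have fixn: "swap_product s (Suc n) = Suc n"
    using s by (intro swap_product_fixes) (auto simp: sorting_networks_def)
  have "s @ rev [1..<Suc n] \<in> sorting_networks (Suc n)"
    unfolding sorting_networks_def mem_Collect_eq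
  proof (intro conjI ballI)
    show "length (s @ rev [1..<Suc n]) = Suc n choose 2"
      using s by (simp add: sorting_networks_def numeral_2_eq_2)
  next
    fix j assume "j \<in> set (s @ rev [1..<Suc n])"
    then show "0 < j" "j < Suc n"
      using s by (force simp: sorting_networks_def)+
  next
    fix i assume i: "i \<in> {1..Suc n}"
    show "swap_product (s @ rev [1..<Suc n]) i = Suc n + 1 - i"
    proof (cases "i = 1")
      case True
      then show ?thesis
        using fixn swap_product_rev_upt[of n 1] by (simp add: swap_product_append del: upt_Suc)
    next
      case False
      then have "i - 1 \<in> {1..n}" using i by auto
      then have "swap_product s (i - 1) = n + 1 - (i - 1)"
        using s by (simp add: sorting_networks_def)
      then show ?thesis
        using i False swap_product_rev_upt[of n i] by (simp add: swap_product_append del: upt_Suc)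
    qed
  qed
  then show ?case by blast
qed


section \<open>Sorting networks generated by planar point sets\<close>

definition general_position :: "(real \<times> real) set \<Rightarrow> bool" where
  "general_position X \<longleftrightarrow>
     inj_on fst X \<and>
     (\<forall>a\<in>X. \<forall>b\<in>X. \<forall>c\<in>X. a \<noteq> b \<and> a \<noteq> c \<and> b \<noteq> c \<longrightarrow> \<not> collinear {a, b, c}) \<and>
     (\<forall>a\<in>X. \<forall>b\<in>X. \<forall>c\<in>X. \<forall>d\<in>X. a \<noteq> b \<and> c \<noteq> d \<and> {a, b} \<noteq> {c, d} \<longrightarrow>
        \<not> affine_parallel (affine hull {a, b}) (affine hull {c, d}))"

definition rotation :: "real \<Rightarrow> real \<times> real \<Rightarrow> real \<times> real" where
  "rotation \<phi> p = (fst p * cos \<phi> - snd p * sin \<phi>, fst p * sin \<phi> + snd p * cos \<phi>)"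

text \<open>The position, counted from 1, of a point of \<open>Y\<close> when \<open>Y\<close> is read from left to right.
  The label of a point of \<open>X\<close> is its position in \<open>X\<close> itself.\<close>

definition position :: "(real \<times> real) set \<Rightarrow> real \<times> real \<Rightarrow> nat" where
  "position Y p = card {q \<in> Y. fst q \<le> fst p}"

text \<open>The label read at position \<open>i\<close> in the rotated set. This is meaningful only if the points
  of the rotated set have distinct first coordinates; it is used only for such angles.\<close>

definition reading :: "(real \<times> real) set \<Rightarrow> real \<Rightarrow> nat \<Rightarrow> nat" where
  "reading X \<phi> i =
     position X (THE p. p \<in> X \<and> position (rotation \<phi> ` X) (rotation \<phi> p) = i)"

definition swap_angles :: "(real \<times> real) set \<Rightarrow> real set" where
  "swap_angles X = {\<phi>. 0 < \<phi> \<and> \<phi> < pi \<and> \<not> inj_on fst (rotation \<phi> ` X)}"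

text \<open>The angles \<open>\<theta> 1 < \<dots> < \<theta> N\<close> enumerate the swap angles in increasing order, with
  \<open>\<theta> 0 = 0\<close> and \<open>\<theta> (N + 1) = \<pi>\<close>. List indices start at 0, so \<open>s ! k\<close> is the swap at
  \<open>\<theta> (k + 1)\<close>. Precomposition with \<open>adj_swap j\<close> exchanges the labels at positions \<open>j\<close> and
  \<open>j + 1\<close>.\<close>

definition generates :: "(real \<times> real) set \<Rightarrow> nat list \<Rightarrow> bool" where
  "generates X s \<longleftrightarrow>
     (\<exists>\<theta>::nat \<Rightarrow> real.
        \<theta> 0 = 0 \<and> \<theta> (length s + 1) = pi \<and> strict_mono_on {0..length s + 1} \<theta> \<and>
        swap_angles X = \<theta> ` {1..length s} \<and>
        (\<forall>k<length s. \<forall>\<alpha>\<in>{\<theta> k<..<\<theta> (k + 1)}. \<forall>\<beta>\<in>{\<theta> (k + 1)<..<\<theta> (k + 2)}.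
           \<forall>i\<in>{1..card X}. reading X \<beta> i = (reading X \<alpha> \<circ> adj_swap (s ! k)) i))"

definition geometrically_realizable :: "nat \<Rightarrow> nat list \<Rightarrow> bool" where
  "geometrically_realizable n s \<longleftrightarrow>
     s \<in> sorting_networks n \<and>
     (\<exists>X. finite X \<and> card X = n \<and> general_position X \<and> generates X s)"

end

theory Submission
  imports Defs "HOL-Real_Asymp.Real_Asymp"
begin

text \<open>There are far too few realizable networks. The network generated by a point set depends only
  on the order of the slopes of the lines through two of its points, that is, on the signs of at most
  \<open>n\<^sup>4\<close> quadratic polynomials in the coordinates, so Warren's bound on the number of sign patterns
  leaves at most \<open>exp (O(n log n))\<close> realizable networks. On the other hand there are at least
  \<open>2\<^bsup>\<Omega>(n\<^sup>2)\<^esup>\<close> networks: reverse the left and the right half of \<open>1, \<dots>, n\<close> independently,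
  interleaving their commuting swaps arbitrarily, and then exchange the two halves.\<close>

section \<open>Sign patterns of real polynomials\<close>

text \<open>Counting slope orders naively leaves up to \<open>(n choose 2)!\<close> of them, far
  more than the lower bound on the number of networks. The gain is that a point set has only
  \<open>2 * n\<close> real parameters: in Warren's bound these form the exponent, while the number
  and the degree of the polynomials enter only the base. General position makes every comparison of
  two different slopes nonzero, so strict sign patterns suffice, with one sample vector per network;
  connected components of sign regions never appear. Bounding the number of critical points is then
  pure linear algebra: a nonzero weighting of finitely many separated points cannot annihilate all
  polynomials. Quadratic comparisons, at most \<open>n ^ 4\<close> in number, give the base
  \<open>4 * n ^ 4 + 1\<close>.\<close>

definition monomial_fun :: "nat \<Rightarrow> (nat \<Rightarrow> nat) \<Rightarrow> (nat \<Rightarrow> real) \<Rightarrow> real" where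
  "monomial_fun v a x = (\<Prod>i<v. x i ^ a i)"

text \<open>Polynomials are kept as functions, and \<open>d\<close> only bounds the total degree, so
  no normal form is needed. Adding one monomial at a time turns the closure properties into
  inductions. Arguments are infinite sequences of which only the first \<open>v\<close> entries
  count, see \<open>poly_fun_cong\<close>.\<close>

inductive poly_fun :: "nat \<Rightarrow> nat \<Rightarrow> ((nat \<Rightarrow> real) \<Rightarrow> real) \<Rightarrow> bool" for v d where
  zero: "poly_fun v d (\<lambda>x. 0)"
| add_monomial: "sum a {..<v} \<le> d \<Longrightarrow> poly_fun v d f \<Longrightarrow> poly_fun v d (\<lambda>x. c * monomial_fun v a x + f x)"

lemma poly_fun_monomial_fun: "sum a {..<v} \<le> d \<Longrightarrow> poly_fun v d (\<lambda>x. c * monomial_fun v a x)"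
  using poly_fun.add_monomial[OF _ poly_fun.zero] by simp

lemma poly_fun_add: "poly_fun v d f \<Longrightarrow> poly_fun v d g \<Longrightarrow> poly_fun v d (\<lambda>x. f x + g x)"
  by (induction rule: poly_fun.induct) (auto simp: add.assoc intro: poly_fun.intros)

lemma monomial_fun_mult: "monomial_fun v a x * monomial_fun v b x = monomial_fun v (\<lambda>i. a i + b i) x"
  by (simp add: monomial_fun_def power_add prod.distrib)

lemma poly_fun_mono_mult:
  assumes "poly_fun v d f" "sum a {..<v} \<le> e"
  shows "poly_fun v (d + e) (\<lambda>x. c * monomial_fun v a x * f x)"
  using assms(1)
proof induction
  case zero
  then show ?case by (simp add: poly_fun.zero)
next
  case (add_monomial b f k)
  have eq: "c * monomial_fun v a x * (k * monomial_fun v b x + f x) =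
      (c * k) * monomial_fun v (\<lambda>i. a i + b i) x + c * monomial_fun v a x * f x" for x
    unfolding monomial_fun_mult[symmetric] by (simp add: algebra_simps)
  show ?case
    unfolding eq using add_monomial assms(2)
    by (intro poly_fun.add_monomial) (auto simp: sum.distrib)
qed

lemma poly_fun_mult:
  assumes "poly_fun v d f" "poly_fun v e g"
  shows "poly_fun v (d + e) (\<lambda>x. f x * g x)"
  using assms(1)
proof induction
  case zero
  then show ?case by (simp add: poly_fun.zero)
next
  case (add_monomial a f c)
  then show ?case
    using poly_fun_add[OF poly_fun_mono_mult[OF assms(2) add_monomial(1)]]
    by (simp add: algebra_simps)
qed

lemma poly_fun_const: "poly_fun v d (\<lambda>x. c)"
  using poly_fun_monomial_fun[of "\<lambda>_. 0" v d c] by (simp add: monomial_fun_def)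

lemma poly_fun_cmult: "poly_fun v d f \<Longrightarrow> poly_fun v d (\<lambda>x. c * f x)"
  using poly_fun_mult[OF poly_fun_const[of v 0 c]] by simp

lemma poly_fun_diff: "poly_fun v d f \<Longrightarrow> poly_fun v d g \<Longrightarrow> poly_fun v d (\<lambda>x. f x - g x)"
  using poly_fun_add[OF _ poly_fun_cmult[of v d g "-1"]] by simp

lemma poly_fun_coord:
  assumes "i < v"
  shows "poly_fun v 1 (\<lambda>x. x i)"
proof -
  have "monomial_fun v (\<lambda>j. if j = i then 1 else 0) x = x i" for x
  proof -
    have "monomial_fun v (\<lambda>j. if j = i then 1 else 0) x = (\<Prod>j<v. if j = i then x i else 1)"
      unfolding monomial_fun_def by (intro prod.cong) auto
    then show ?thesis using assms by simp
  qed
  moreover have "sum (\<lambda>j. if j = i then 1 else 0) {..<v} \<le> (1::nat)" by auto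
  ultimately show ?thesis
    using poly_fun_monomial_fun[of "\<lambda>j. if j = i then 1 else 0" v 1 1] by simp
qed

lemma poly_fun_prod:
  assumes "finite A" "\<And>j. j \<in> A \<Longrightarrow> poly_fun v d (f j)"
  shows "poly_fun v (d * card A) (\<lambda>x. \<Prod>j\<in>A. f j x)"
  using assms
proof (induction A rule: finite_induct)
  case empty
  then show ?case by (simp add: poly_fun_const)
next
  case (insert j A)
  then show ?case using poly_fun_mult[of v d "f j" "d * card A"] by simp
qed

lemma monomial_fun_upd:
  assumes "i < v"
  shows "monomial_fun v a (x(i := t)) = t ^ a i * (\<Prod>j\<in>{..<v} - {i}. x j ^ a j)"
proof -
  have "monomial_fun v a (x(i := t)) = (x(i := t)) i ^ a i * (\<Prod>j\<in>{..<v} - {i}. (x(i := t)) j ^ a j)"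
    unfolding monomial_fun_def using assms by (intro prod.remove) auto
  also have "(\<Prod>j\<in>{..<v} - {i}. (x(i := t)) j ^ a j) = (\<Prod>j\<in>{..<v} - {i}. x j ^ a j)"
    by (intro prod.cong) auto
  finally show ?thesis by (simp only: fun_upd_same)
qed

lemma poly_fun_partial_derivative:
  assumes "poly_fun v d f" "i < v"
  shows "\<exists>g. poly_fun v d g \<and> (\<forall>x. ((\<lambda>t. f (x(i := t))) has_real_derivative g x) (at (x i)))"
  using assms(1)
proof induction
  case zero
  then show ?case by (intro exI[of _ "\<lambda>x. 0"]) (auto intro: poly_fun.zero)
next
  case (add_monomial a f c)
  then obtain g where g: "poly_fun v d g"
    "\<And>x. ((\<lambda>t. f (x(i := t))) has_real_derivative g x) (at (x i))" by blast
  \<comment> \<open>At \<open>a i = 0\<close> the truncated subtraction leaves the exponent at 0,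
    which is harmless because the coefficient \<open>c * a i\<close> is then 0.\<close>
  let ?b = "a(i := a i - 1)"
  have sb: "sum ?b {..<v} \<le> d"
    by (rule order_trans[OF sum_mono add_monomial(1)]) auto
  have upd: "monomial_fun v b x = x i ^ b i * (\<Prod>j\<in>{..<v} - {i}. x j ^ b j)" for b x
    using monomial_fun_upd[OF assms(2), of b x "x i"] by simp
  have prod_eq: "(\<Prod>j\<in>{..<v} - {i}. x j ^ ?b j) = (\<Prod>j\<in>{..<v} - {i}. x j ^ a j)" for x :: "nat \<Rightarrow> real"
    by (intro prod.cong) auto
  show ?case
  proof (intro exI[of _ "\<lambda>x. (c * a i) * monomial_fun v ?b x + g x"] conjI allI)
    show "poly_fun v d (\<lambda>x. (c * a i) * monomial_fun v ?b x + g x)"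
      using sb g(1) by (rule poly_fun.add_monomial)
    fix x :: "nat \<Rightarrow> real"
    show "((\<lambda>t. c * monomial_fun v a (x(i := t)) + f (x(i := t))) has_real_derivative
        (c * a i) * monomial_fun v ?b x + g x) (at (x i))"
      unfolding monomial_fun_upd[OF assms(2)] upd[of ?b] prod_eq
      by (rule derivative_eq_intros g(2) refl)+ (simp add: algebra_simps)
  qed
qed

text \<open>Every monomial is at most \<open>M ^ d\<close> once \<open>M \<ge> 1\<close> dominates
  the coordinates. This is the growth that a penalty of higher degree has to beat far from the
  origin.\<close>

lemma poly_fun_bound:
  assumes "poly_fun v d f"
  shows "\<exists>C\<ge>0. \<forall>x M. 1 \<le> M \<longrightarrow> (\<forall>i<v. \<bar>x i\<bar> \<le> M) \<longrightarrow> \<bar>f x\<bar> \<le> C * M ^ d"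
  using assms
proof induction
  case zero
  then show ?case by (intro exI[of _ 0]) auto
next
  case (add_monomial a f c)
  then obtain C where C: "C \<ge> 0"
    "\<And>x M. 1 \<le> M \<Longrightarrow> (\<And>i. i < v \<Longrightarrow> \<bar>x i\<bar> \<le> M) \<Longrightarrow> \<bar>f x\<bar> \<le> C * M ^ d" by blast
  have "\<bar>c * monomial_fun v a x + f x\<bar> \<le> (\<bar>c\<bar> + C) * M ^ d" if M: "1 \<le> M" "\<And>i. i < v \<Longrightarrow> \<bar>x i\<bar> \<le> M" for x M
  proof -
    have "\<bar>monomial_fun v a x\<bar> = (\<Prod>i<v. \<bar>x i\<bar> ^ a i)"
      by (simp add: monomial_fun_def abs_prod power_abs)
    also have "\<dots> \<le> (\<Prod>i<v. M ^ a i)"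
      using M by (intro prod_mono) (auto intro: power_mono)
    also have "\<dots> = M ^ sum a {..<v}" by (simp add: power_sum)
    also have "\<dots> \<le> M ^ d" using M add_monomial(1) by (intro power_increasing) auto
    finally have "\<bar>c * monomial_fun v a x\<bar> \<le> \<bar>c\<bar> * M ^ d" by (simp add: abs_mult mult_left_mono)
    then show ?thesis using C(2)[of M x] M by (simp add: algebra_simps)
  qed
  then show ?case using C(1) by (intro exI[of _ "\<bar>c\<bar> + C"]) auto
qed

lemma poly_fun_continuous:
  assumes "poly_fun v d f"
  shows "continuous_on UNIV f"
  using assms
proof induction
  case zero
  then show ?case by simp
next
  case (add_monomial a f c)
  then show ?case
    unfolding monomial_fun_def by (intro continuous_intros) auto
qed

section \<open>Counting solutions by linear algebra\<close>

text \<open>Gaussian elimination: an unknown \<open>z0\<close> with nonzero coefficient in equation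
  \<open>a\<close> is eliminated from the other equations and recovered from \<open>a\<close> at the
  end, at the cost of one equation and one unknown.\<close>

lemma underdetermined_system:
  fixes m :: "'a \<Rightarrow> 'b \<Rightarrow> real"
  assumes "finite A" "finite Z" "card A < card Z"
  shows "\<exists>c. (\<exists>z\<in>Z. c z \<noteq> 0) \<and> (\<forall>a\<in>A. (\<Sum>z\<in>Z. c z * m a z) = 0)"
  using assms
proof (induction A arbitrary: Z m rule: finite_induct)
  case empty
  then have "Z \<noteq> {}" by auto
  then show ?case by (intro exI[of _ "\<lambda>_. 1"]) auto
next
  case (insert a A)
  show ?case
  proof (cases "\<forall>z\<in>Z. m a z = 0")
    case True
    then show ?thesis using insert.IH[of Z m] insert.prems insert.hyps by auto
  next
    case False
    then obtain z0 where z0: "z0 \<in> Z" "m a z0 \<noteq> 0" by blast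
    let ?Z = "Z - {z0}"
    let ?m = "\<lambda>b z. m b z - m b z0 * m a z / m a z0"
    have "card A < card ?Z" using insert z0 by simp
    then obtain c where c: "\<exists>z\<in>?Z. c z \<noteq> 0" "\<And>b. b \<in> A \<Longrightarrow> (\<Sum>z\<in>?Z. c z * ?m b z) = 0"
      using insert.IH[of ?Z ?m] insert.prems by auto
    define c' where "c' = c(z0 := - (\<Sum>z\<in>?Z. c z * m a z) / m a z0)"
    have split: "(\<Sum>z\<in>Z. c' z * m b z) =
        - (\<Sum>z\<in>?Z. c z * m a z) / m a z0 * m b z0 + (\<Sum>z\<in>?Z. c z * m b z)" for b
    proof -
      have "(\<Sum>z\<in>Z. c' z * m b z) = c' z0 * m b z0 + (\<Sum>z\<in>?Z. c' z * m b z)"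
        using insert.prems z0 by (intro sum.remove) auto
      also have "(\<Sum>z\<in>?Z. c' z * m b z) = (\<Sum>z\<in>?Z. c z * m b z)"
        by (intro sum.cong) (auto simp: c'_def)
      finally show ?thesis by (simp add: c'_def)
    qed
    have "(\<Sum>z\<in>Z. c' z * m b z) = 0" if "b \<in> A" for b
    proof -
      have "0 = (\<Sum>z\<in>?Z. c z * m b z - (c z * m a z) * (m b z0 / m a z0))"
        using c(2)[OF that] by (simp add: algebra_simps)
      also have "\<dots> = (\<Sum>z\<in>?Z. c z * m b z) - (\<Sum>z\<in>?Z. c z * m a z) * (m b z0 / m a z0)"
        by (simp add: sum_subtractf sum_distrib_right sum_divide_distrib)
      finally show ?thesis unfolding split by (simp add: algebra_simps)
    qed
    moreover have "(\<Sum>z\<in>Z. c' z * m a z) = 0" unfolding split using z0 by simp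
    moreover have "\<exists>z\<in>Z. c' z \<noteq> 0" using c(1) by (auto simp: c'_def)
    ultimately show ?thesis by (intro exI[of _ c']) auto
  qed
qed

text \<open>Monomials with all exponents below \<open>e\<close> span all polynomial functions on \<open>Z\<close>, and the
  latter separate the points of \<open>Z\<close>: Bezout's bound for systems with leading forms \<open>x\<^sub>i\<^bsup>e\<^esup>\<close>.\<close>

lemma card_solutions_le:
  fixes Z :: "(nat \<Rightarrow> real) set"
  assumes Z: "finite Z"
    and separated: "\<And>z w. z \<in> Z \<Longrightarrow> w \<in> Z \<Longrightarrow> z \<noteq> w \<Longrightarrow> \<exists>i<v. z i \<noteq> w i"
    and reduce: "\<And>i. i < v \<Longrightarrow> \<exists>g. poly_fun v d g \<and> (\<forall>z\<in>Z. z i ^ e = g z)"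
    and "d < e"
  shows "card Z \<le> e ^ v"
proof (rule ccontr)
  assume "\<not> card Z \<le> e ^ v"
  define B where "B = PiE {..<v} (\<lambda>_. {..<e})"
  have "finite B" "card B < card Z"
    using \<open>\<not> card Z \<le> e ^ v\<close> by (auto simp: B_def card_PiE intro: finite_PiE)
  \<comment> \<open>With more points than reduced monomials, some nonzero weighting \<open>c\<close>
    of \<open>Z\<close> annihilates all monomials in \<open>B\<close>. The contradiction will be
    that it annihilates every polynomial function.\<close>
  then obtain c where c: "\<exists>z\<in>Z. c z \<noteq> 0" "\<And>a. a \<in> B \<Longrightarrow> (\<Sum>z\<in>Z. c z * monomial_fun v a z) = 0"
    using underdetermined_system[OF _ Z] by blast
  have lift: "(\<Sum>z\<in>Z. c z * f z) = 0"
    if "poly_fun v k f" "\<And>a. sum a {..<v} \<le> k \<Longrightarrow> (\<Sum>z\<in>Z. c z * monomial_fun v a z) = 0" for k f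
    using that
  proof induction
    case (add_monomial a f r)
    have "(\<Sum>z\<in>Z. c z * (r * monomial_fun v a z + f z)) =
        r * (\<Sum>z\<in>Z. c z * monomial_fun v a z) + (\<Sum>z\<in>Z. c z * f z)"
      by (simp add: sum_distrib_left sum.distrib algebra_simps)
    then show ?case using add_monomial by simp
  qed simp
  \<comment> \<open>Induction on the total degree: replacing a factor \<open>z i ^ e\<close> by
    \<open>g z\<close>, of degree at most \<open>d < e\<close>, expresses the monomial on
    \<open>Z\<close> through monomials of strictly smaller degree.\<close>
  have mono0: "(\<Sum>z\<in>Z. c z * monomial_fun v a z) = 0" for a
  proof (induction "sum a {..<v}" arbitrary: a rule: less_induct)
    case less
    show ?case
    proof (cases "\<forall>i<v. a i < e")
      case True
      then have "restrict a {..<v} \<in> B" by (auto simp: B_def)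
      moreover have "monomial_fun v (restrict a {..<v}) z = monomial_fun v a z" for z
        unfolding monomial_fun_def by (intro prod.cong) auto
      ultimately show ?thesis using c(2)[of "restrict a {..<v}"] by simp
    next
      case False
      then obtain i where i: "i < v" "e \<le> a i" by (auto simp: not_less)
      obtain g where g: "poly_fun v d g" "\<And>z. z \<in> Z \<Longrightarrow> z i ^ e = g z"
        using reduce[OF i(1)] by blast
      let ?b = "a(i := a i - e)"
      have "sum a {..<v} = a i + sum a ({..<v} - {i})"
        using i by (intro sum.remove) auto
      moreover have "sum ?b {..<v} = ?b i + sum ?b ({..<v} - {i})"
        using i by (intro sum.remove) auto
      moreover have "sum ?b ({..<v} - {i}) = sum a ({..<v} - {i})"
        by (intro sum.cong) auto
      ultimately have deg: "d + sum ?b {..<v} < sum a {..<v}"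
        using i(2) \<open>d < e\<close> by simp
      have "monomial_fun v a z = 1 * monomial_fun v ?b z * g z" if "z \<in> Z" for z
      proof -
        have "monomial_fun v a z = z i ^ a i * (\<Prod>j\<in>{..<v} - {i}. z j ^ a j)"
          using monomial_fun_upd[OF i(1), of a z "z i"] by simp
        moreover have "monomial_fun v ?b z = z i ^ (a i - e) * (\<Prod>j\<in>{..<v} - {i}. z j ^ ?b j)"
          using monomial_fun_upd[OF i(1), of ?b z "z i"] by simp
        moreover have "(\<Prod>j\<in>{..<v} - {i}. z j ^ ?b j) = (\<Prod>j\<in>{..<v} - {i}. z j ^ a j)"
          by (intro prod.cong) auto
        moreover have "z i ^ a i = z i ^ (a i - e) * g z"
          using i(2) unfolding g(2)[OF that, symmetric] power_add[symmetric] by simp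
        ultimately show ?thesis by simp
      qed
      then have "(\<Sum>z\<in>Z. c z * monomial_fun v a z) = (\<Sum>z\<in>Z. c z * (1 * monomial_fun v ?b z * g z))"
        by (intro sum.cong) auto
      also have "\<dots> = 0"
      proof (rule lift[OF poly_fun_mono_mult[OF g(1) order_refl]])
        fix b assume "sum b {..<v} \<le> d + sum ?b {..<v}"
        then show "(\<Sum>z\<in>Z. c z * monomial_fun v b z) = 0" using deg by (intro less) linarith
      qed
      finally show ?thesis .
    qed
  qed
  obtain z0 where z0: "z0 \<in> Z" "c z0 \<noteq> 0" using c(1) by blast
  obtain i where i: "\<And>w. w \<in> Z - {z0} \<Longrightarrow> i w < v \<and> z0 (i w) \<noteq> w (i w)"
    using separated[OF z0(1)] by (metis DiffE insertI1)
  \<comment> \<open>As in Lagrange interpolation: one separating linear factor for each other point,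
    so that on \<open>Z\<close> only \<open>z0\<close> survives.\<close>
  define h where "h x = (\<Prod>w\<in>Z - {z0}. x (i w) - w (i w))" for x :: "nat \<Rightarrow> real"
  have "poly_fun v (1 * card (Z - {z0})) h"
    unfolding h_def using Z i
    by (intro poly_fun_prod poly_fun_diff poly_fun_coord poly_fun_const) auto
  then have "(\<Sum>z\<in>Z. c z * h z) = 0" by (rule lift) (rule mono0)
  moreover have "h z = 0" if "z \<in> Z - {z0}" for z
    unfolding h_def using that Z by (intro prod_zero) auto
  then have "(\<Sum>z\<in>Z. c z * h z) = (\<Sum>z\<in>{z0}. c z * h z)"
    using Z z0 by (intro sum.mono_neutral_right) auto
  moreover have "h z0 \<noteq> 0" unfolding h_def using i Z by auto
  ultimately show False using z0 by simp
qed

lemma poly_fun_cong: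
  assumes "poly_fun v d f" "\<And>i. i < v \<Longrightarrow> x i = y i"
  shows "f x = f y"
  using assms(1)
proof induction
  case (add_monomial a f c)
  moreover have "monomial_fun v a x = monomial_fun v a y"
    unfolding monomial_fun_def using assms(2) by (intro prod.cong) auto
  ultimately show ?case by simp
qed simp

text \<open>Warren's bound. Inside each sign region, \<open>P\<^sup>2 - \<delta> \<Sum>x\<^sub>i\<^bsup>2D+2\<^esup>\<close> attains a positive
  maximum, as it is nonpositive where \<open>P = 0\<close> and negative far out. This gives one critical point
  per region, and at a critical point \<open>x\<^sub>i\<^bsup>2D+1\<^esup>\<close> is a polynomial of degree at most \<open>2D\<close>.\<close>

theorem card_sign_patterns_le:
  fixes f :: "'j \<Rightarrow> (nat \<Rightarrow> real) \<Rightarrow> real"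
  assumes J: "finite J" and U: "finite U"
    and poly: "\<And>j. j \<in> J \<Longrightarrow> poly_fun v d (f j)"
    and nz: "\<And>u j. u \<in> U \<Longrightarrow> j \<in> J \<Longrightarrow> f j u \<noteq> 0"
    and distinct: "\<And>u w. u \<in> U \<Longrightarrow> w \<in> U \<Longrightarrow> u \<noteq> w \<Longrightarrow> \<exists>j\<in>J. (0 < f j u) \<noteq> (0 < f j w)"
  shows "card U \<le> (2 * (d * card J) + 1) ^ v"
proof -
  define D where "D = d * card J"
  define P where "P x = (\<Prod>j\<in>J. f j x)" for x
  define S :: "(nat \<Rightarrow> real) \<Rightarrow> real" where "S x = (\<Sum>i<v. x i ^ (2 * D + 2))" for x
  have polyP: "poly_fun v D P"
    unfolding P_def D_def using J poly by (rule poly_fun_prod)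
  have S_nonneg: "0 \<le> S x" for x
    unfolding S_def by (intro sum_nonneg zero_le_even_power) simp
  have P_nz: "P u \<noteq> 0" if "u \<in> U" for u
    unfolding P_def using J nz that by simp
  \<comment> \<open>Small enough for \<open>P\<^sup>2 - \<delta> * S\<close> to stay positive at
    every sample point. The summand 1 keeps the denominators positive and the inequality strict; the
    inserted element 1 covers an empty \<open>U\<close>.\<close>
  define \<delta> where "\<delta> = Min (insert 1 ((\<lambda>u. (P u)\<^sup>2 / (S u + 1)) ` U))"
  have \<delta>_pos: "0 < \<delta>"
    unfolding \<delta>_def using U P_nz S_nonneg
    by (subst Min_gr_iff) (auto intro!: divide_pos_pos add_nonneg_pos)
  have \<delta>_less: "\<delta> * S u < (P u)\<^sup>2" if "u \<in> U" for u
  proof -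
    have "\<delta> \<le> (P u)\<^sup>2 / (S u + 1)"
      unfolding \<delta>_def using U that by (intro Min_le) auto
    then have "\<delta> * (S u + 1) \<le> (P u)\<^sup>2"
      using S_nonneg[of u] by (simp add: pos_le_divide_eq)
    then show ?thesis using \<delta>_pos by (simp add: algebra_simps)
  qed
  define G where "G x = (P x)\<^sup>2 - \<delta> * S x" for x
  obtain C where C: "C \<ge> 0"
    "\<And>x M. 1 \<le> M \<Longrightarrow> (\<And>i. i < v \<Longrightarrow> \<bar>x i\<bar> \<le> M) \<Longrightarrow> \<bar>P x\<bar> \<le> C * M ^ D"
    using poly_fun_bound[OF polyP] by blast
  \<comment> \<open>Chosen so that \<open>C\<^sup>2 < \<delta> * R\<close>. If the largest
    coordinate \<open>M\<close> is at least \<open>R\<close>, then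
    \<open>C\<^sup>2 * M ^ (2 * D)\<close>, which bounds \<open>P\<^sup>2\<close>, is below
    \<open>\<delta> * M ^ (2 * D + 2)\<close>.\<close>
  define R where "R = 1 + C\<^sup>2 / \<delta>"
  have R1: "1 \<le> R" using \<delta>_pos by (simp add: R_def)
  have G_neg: "G x < 0" if i: "i < v" "R \<le> \<bar>x i\<bar>" for x i
  proof -
    define M where "M = Max ((\<lambda>i. \<bar>x i\<bar>) ` {..<v})"
    have le_M: "\<bar>x k\<bar> \<le> M" if "k < v" for k
      unfolding M_def using that by (intro Max_ge) auto
    have "M \<in> (\<lambda>i. \<bar>x i\<bar>) ` {..<v}"
      unfolding M_def using i by (intro Max_in) auto
    then obtain k where k: "k < v" "M = \<bar>x k\<bar>" by blast
    have RM: "R \<le> M" using i le_M[OF i(1)] by linarith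
    have "(P x)\<^sup>2 \<le> (C * M ^ D)\<^sup>2"
      using C(2)[of M x] le_M RM R1 by (intro abs_le_square_iff[THEN iffD1]) auto
    moreover have "\<delta> * M ^ (2 * D + 2) \<le> \<delta> * S x"
    proof -
      have "M ^ (2 * D + 2) = x k ^ (2 * D + 2)"
        unfolding k(2) by (rule power_even_abs) simp
      also have "\<dots> \<le> S x"
        unfolding S_def using k by (intro member_le_sum zero_le_even_power) auto
      finally show ?thesis using \<delta>_pos by (intro mult_left_mono) auto
    qed
    moreover have "(C * M ^ D)\<^sup>2 < \<delta> * M ^ (2 * D + 2)"
    proof -
      have "C\<^sup>2 < \<delta> * R" using \<delta>_pos by (simp add: R_def field_simps)
      also have "\<dots> \<le> \<delta> * M\<^sup>2"
        using \<delta>_pos R1 RM mult_mono[of 1 M R M] by (simp add: power2_eq_square)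
      finally have "C\<^sup>2 * M ^ (2 * D) < \<delta> * M\<^sup>2 * M ^ (2 * D)"
        using R1 RM by simp
      moreover have "(C * M ^ D)\<^sup>2 = C\<^sup>2 * M ^ (2 * D)"
        by (simp add: power_mult_distrib power_even_eq)
      moreover have "\<delta> * M\<^sup>2 * M ^ (2 * D) = \<delta> * M ^ (2 * D + 2)"
        unfolding power_add by (simp only: mult_ac)
      ultimately show ?thesis by (simp only:)
    qed
    ultimately show ?thesis unfolding G_def by linarith
  qed
  have contG: "continuous_on UNIV G"
    unfolding G_def S_def
    by (intro continuous_intros poly_fun_continuous[OF polyP]) auto
  have "\<exists>g. \<forall>i<v. poly_fun v D (g i) \<and>
      (\<forall>x. ((\<lambda>t. P (x(i := t))) has_real_derivative g i x) (at (x i)))"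
    using poly_fun_partial_derivative[OF polyP] by metis
  then obtain g where g: "\<And>i. i < v \<Longrightarrow> poly_fun v D (g i)"
    "\<And>i x. i < v \<Longrightarrow> ((\<lambda>t. P (x(i := t))) has_real_derivative g i x) (at (x i))" by blast
  have critical: "\<exists>z. (\<forall>j\<in>J. 0 < f j z * f j u) \<and>
      (\<forall>i<v. z i ^ (2 * D + 1) = 2 / (\<delta> * real (2 * D + 2)) * (P z * g i z))"
    if u: "u \<in> U" for u
  proof -
    \<comment> \<open>Coordinates from index \<open>v\<close> on are frozen at those of
      \<open>u\<close>. All factors are then compact, and Tychonoff's theorem makes \<open>K\<close>
      compact in the product topology.\<close>
    define K where "K = PiE UNIV (\<lambda>i. if i < v then {-R..R} else {u i})"
    define F where "F = K \<inter> (\<Inter>j\<in>J. {x. 0 \<le> f j x * f j u})"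
    have "compact K" using compactin_PiE[of "\<lambda>_. euclidean" UNIV "\<lambda>i. if i < v then {-R..R} else {u i}"]
    unfolding K_def euclidean_product_topology compactin_euclidean_iff by auto
    moreover have "closed (\<Inter>j\<in>J. {x. 0 \<le> f j x * f j u})"
      by (intro closed_INT ballI closed_Collect_le continuous_intros poly_fun_continuous[OF poly])
    ultimately have "compact F" unfolding F_def by (rule compact_Int_closed)
    have Gu: "0 < G u" using \<delta>_less[OF u] by (simp add: G_def)
    have uR: "\<bar>u i\<bar> < R" if "i < v" for i
      using G_neg[OF that, of u] Gu by linarith
    have "u \<in> F" unfolding F_def K_def by (force dest: uR)
    then obtain z where z: "z \<in> F" "\<And>x. x \<in> F \<Longrightarrow> G x \<le> G z"
      using continuous_attains_sup[OF \<open>compact F\<close> _ continuous_on_subset[OF contG]] by blast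
    have Gz: "0 < G z" using Gu z(2)[OF \<open>u \<in> F\<close>] by linarith
    \<comment> \<open>Positivity of \<open>G\<close> keeps the maximiser off the zero set of
      \<open>P\<close>, so the weak sign conditions defining \<open>F\<close> hold strictly at
      \<open>z\<close>. It also keeps \<open>z\<close> off the faces of the box.\<close>
    have "P z \<noteq> 0" using Gz mult_nonneg_nonneg[OF less_imp_le[OF \<delta>_pos] S_nonneg[of z]]
      by (auto simp: G_def)
    then have fz: "0 < f j z * f j u" if "j \<in> J" for j
      using z(1) that nz[OF u that] J unfolding F_def P_def by (force simp: less_le)
    have zR: "\<bar>z i\<bar> < R" if "i < v" for i
      using G_neg[OF that, of z] Gz by linarith
    have "z i ^ (2 * D + 1) = 2 / (\<delta> * real (2 * D + 2)) * (P z * g i z)" if i: "i < v" for i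
    proof -
      \<comment> \<open>The strict conditions persist nearby, so \<open>z\<close> can be moved along
        the \<open>i\<close>-th axis inside \<open>F\<close>, and the one-variable criterion for a
        local maximum applies.\<close>
      have near: "\<forall>\<^sub>F t in nhds (z i). z(i := t) \<in> F"
      proof -
        have "\<forall>\<^sub>F t in nhds (z i). 0 < f j (z(i := t)) * f j u" if j: "j \<in> J" for j
        proof -
          obtain h where "((\<lambda>t. f j (z(i := t))) has_real_derivative h z) (at (z i))"
            using poly_fun_partial_derivative[OF poly[OF j] i] by blast
          then have "isCont (\<lambda>t. f j (z(i := t)) * f j u) (z i)"
            by (intro continuous_intros DERIV_isCont)
          then have "((\<lambda>t. f j (z(i := t)) * f j u) \<longlongrightarrow> f j (z(i := z i)) * f j u) (nhds (z i))"
            unfolding isCont_def by (rule tendsto_at_iff_tendsto_nhds[THEN iffD1])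
          then show ?thesis using fz[OF j] by (intro order_tendstoD) auto
        qed
        then have "\<forall>\<^sub>F t in nhds (z i). \<forall>j\<in>J. 0 < f j (z(i := t)) * f j u"
          using J by (simp add: eventually_ball_finite)
        moreover have "\<forall>\<^sub>F t in nhds (z i). t \<in> {-R<..<R}"
          using zR[OF i] by (intro eventually_nhds_in_open) auto
        ultimately show ?thesis
          by eventually_elim
            (use z(1) i in \<open>auto simp: F_def K_def PiE_iff less_imp_le split: if_splits\<close>)
      qed
      have S_upd: "S (z(i := t)) = t ^ (2 * D + 2) + (\<Sum>k\<in>{..<v} - {i}. z k ^ (2 * D + 2))" for t
      proof -
        have "S (z(i := t)) = (z(i := t)) i ^ (2 * D + 2) +
            (\<Sum>k\<in>{..<v} - {i}. (z(i := t)) k ^ (2 * D + 2))"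
          unfolding S_def using i by (intro sum.remove) auto
        also have "(\<Sum>k\<in>{..<v} - {i}. (z(i := t)) k ^ (2 * D + 2)) = (\<Sum>k\<in>{..<v} - {i}. z k ^ (2 * D + 2))"
          by (intro sum.cong) auto
        finally show ?thesis by (simp only: fun_upd_same)
      qed
      have "((\<lambda>t. G (z(i := t))) has_real_derivative
          2 * P z * g i z - \<delta> * (real (2 * D + 2) * z i ^ (2 * D + 1))) (at (z i))"
        unfolding G_def S_upd
        by (rule derivative_eq_intros g(2)[OF i] refl)+ (simp del: power_Suc)
      moreover obtain e where "0 < e" "\<And>t. \<bar>z i - t\<bar> < e \<Longrightarrow> z(i := t) \<in> F"
        using near unfolding eventually_nhds_metric dist_real_def by (metis abs_minus_commute)
      ultimately have "2 * P z * g i z - \<delta> * (real (2 * D + 2) * z i ^ (2 * D + 1)) = 0"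
        using z(2) by (intro DERIV_local_max) auto
      moreover have "y = 2 / (\<delta> * N) * (a * b)" if "2 * a * b - \<delta> * (N * y) = 0" "0 < N" for a b y N
        using that \<delta>_pos by (simp add: field_simps)
      ultimately show ?thesis by simp
    qed
    then show ?thesis using fz by blast
  qed
  then obtain z where z: "\<And>u j. u \<in> U \<Longrightarrow> j \<in> J \<Longrightarrow> 0 < f j (z u) * f j u"
    "\<And>u i. u \<in> U \<Longrightarrow> i < v \<Longrightarrow>
       z u i ^ (2 * D + 1) = 2 / (\<delta> * real (2 * D + 2)) * (P (z u) * g i (z u))"
    by metis
  have sep: "\<exists>i<v. z u i \<noteq> z w i" if uw: "u \<in> U" "w \<in> U" "u \<noteq> w" for u w
  proof (rule ccontr)
    assume "\<not> (\<exists>i<v. z u i \<noteq> z w i)"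
    then have "f j (z u) = f j (z w)" if "j \<in> J" for j
      using poly_fun_cong[OF poly[OF that]] by blast
    moreover obtain j where "j \<in> J" "(0 < f j u) \<noteq> (0 < f j w)"
      using distinct uw by blast
    ultimately show False
      using z(1)[of u j] z(1)[of w j] uw by (auto simp: zero_less_mult_iff)
  qed
  have "card (z ` U) \<le> (2 * D + 1) ^ v"
  proof (rule card_solutions_le)
    show "\<exists>i<v. x i \<noteq> y i" if "x \<in> z ` U" "y \<in> z ` U" "x \<noteq> y" for x y
      using that sep by blast
    show "\<exists>h. poly_fun v (D + D) h \<and> (\<forall>x\<in>z ` U. x i ^ (2 * D + 1) = h x)" if "i < v" for i
      using z(2) that
      by (intro exI[of _ "\<lambda>x. 2 / (\<delta> * real (2 * D + 2)) * (P x * g i x)"] conjI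
          poly_fun_cmult poly_fun_mult polyP g) auto
  qed (use U in auto)
  moreover have "inj_on z U" using sep by (intro inj_onI) metis
  ultimately show ?thesis by (simp add: card_image D_def)
qed

section \<open>Interleaving sorting networks\<close>

text \<open>Each bit decides only the order within one pair of heads. This restricted interleaving
  is easy to invert and already yields a factor 2 per pair.\<close>

fun shuffle :: "bool list \<Rightarrow> 'a list \<Rightarrow> 'a list \<Rightarrow> 'a list" where
  "shuffle (b # bs) (x # s) (y # t) = (if b then [x, y] else [y, x]) @ shuffle bs s t"
| "shuffle _ s t = s @ t"

lemma set_shuffle: "set (shuffle bs s t) = set s \<union> set t"
  by (induction bs s t rule: shuffle.induct) auto

lemma length_shuffle: "length (shuffle bs s t) = length s + length t"
  by (induction bs s t rule: shuffle.induct) auto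

text \<open>The entries of \<open>s\<close> and \<open>t\<close> are disjoint, so the first entry of
  each pair reveals its bit.\<close>

lemma shuffle_inject:
  assumes "set s \<inter> set t = {}" "length bs \<le> length s" "length bs \<le> length t" "length cs = length bs"
    and "shuffle bs s t = shuffle cs s t"
  shows "bs = cs"
  using assms
proof (induction bs s t arbitrary: cs rule: shuffle.induct)
  case (1 b bs x s y t)
  then obtain c cs' where "cs = c # cs'" by (cases cs) auto
  then show ?case using 1 by (auto split: if_splits)
qed auto

lemma swap_product_Cons: "swap_product (x # s) = adj_swap x \<circ> swap_product s"
  by (simp add: swap_product_def)

lemma swap_product_Nil: "swap_product [] = id"
  by (simp add: swap_product_def)

lemma adj_swap_commute: "x + 1 < y \<Longrightarrow> adj_swap x \<circ> adj_swap y = adj_swap y \<circ> adj_swap x"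
  by (auto simp: fun_eq_iff adj_swap_def Transposition.transpose_def)

lemma swap_product_commute:
  assumes "\<forall>x\<in>set s. x + 1 < y"
  shows "adj_swap y \<circ> swap_product s = swap_product s \<circ> adj_swap y"
  using assms
proof (induction s)
  case (Cons x s)
  then have "adj_swap y \<circ> (adj_swap x \<circ> swap_product s) = adj_swap x \<circ> (adj_swap y \<circ> swap_product s)"
    unfolding comp_assoc[symmetric] using adj_swap_commute[of x y] by simp
  moreover have "adj_swap y \<circ> swap_product s = swap_product s \<circ> adj_swap y"
    by (rule Cons.IH) (use Cons.prems in auto)
  ultimately show ?case unfolding swap_product_Cons by (metis comp_assoc)
qed (simp add: swap_product_Nil)

text \<open>The leading swap \<open>y\<close> of the second list commutes past all remaining swaps
  of the first, whose positions are at least two smaller.\<close>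

lemma swap_product_shuffle:
  assumes "\<forall>x\<in>set s. \<forall>y\<in>set t. x + 1 < y"
  shows "swap_product (shuffle bs s t) = swap_product s \<circ> swap_product t"
  using assms
proof (induction bs s t rule: shuffle.induct)
  case (1 b bs x s y t)
  have xy: "adj_swap y \<circ> adj_swap x = adj_swap x \<circ> adj_swap y"
    using 1 by (intro adj_swap_commute[symmetric]) simp
  have "swap_product (shuffle (b # bs) (x # s) (y # t)) =
      adj_swap x \<circ> adj_swap y \<circ> (swap_product s \<circ> swap_product t)"
    using 1 xy by (auto simp: swap_product_Cons simp flip: comp_assoc)
  also have "\<dots> = adj_swap x \<circ> (adj_swap y \<circ> swap_product s) \<circ> swap_product t"
    by (simp add: comp_assoc)
  also have "adj_swap y \<circ> swap_product s = swap_product s \<circ> adj_swap y"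
    using 1 by (intro swap_product_commute) auto
  finally show ?case by (simp add: swap_product_Cons comp_assoc)
qed (simp_all add: swap_product_append swap_product_Nil)

lemma swap_product_shift:
  assumes "\<forall>y\<in>set t. 0 < y"
  shows "swap_product (map ((+) p) t) i = (if i \<le> p then i else p + swap_product t (i - p))"
  using assms
proof (induction t)
  case (Cons y t)
  then show ?case
    by (auto simp: swap_product_Cons adj_swap_def Transposition.transpose_def)
qed (simp add: swap_product_Nil)

lemma swap_product_rev_interval:
  "swap_product (rev [r..<r + p]) i = (if i = r then r + p else if r < i \<and> i \<le> r + p then i - 1 else i)"
proof (induction p arbitrary: i)
  case 0
  then show ?case by (simp add: swap_product_Nil)
next
  case (Suc p)
  then show ?case
    by (auto simp: swap_product_Cons adj_swap_def Transposition.transpose_def)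
qed

section \<open>Exchanging two blocks\<close>

text \<open>Each run is the cycle that maps \<open>r\<close> to \<open>r + p\<close> and lowers
  \<open>r + 1\<close> to \<open>r + p\<close> by one. The \<open>q\<close> runs use one swap for
  each pair of elements from different blocks, which leaves exactly the length needed for reversing
  both blocks.\<close>

definition block_exchange :: "nat \<Rightarrow> nat \<Rightarrow> nat list" where
  "block_exchange p q = concat (map (\<lambda>r. rev [r..<r + p]) [1..<Suc q])"

lemma block_exchange_Suc: "block_exchange p (Suc q) = block_exchange p q @ rev [Suc q..<Suc q + p]"
  by (simp add: block_exchange_def)

lemma length_block_exchange: "length (block_exchange p q) = p * q"
  by (induction q) (simp_all add: block_exchange_Suc block_exchange_def[of p 0])

lemma set_block_exchange: "j \<in> set (block_exchange p q) \<Longrightarrow> 0 < j \<and> j < p + q"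
  by (auto simp: block_exchange_def)

lemma swap_product_block_exchange:
  "i \<in> {1..p + q} \<Longrightarrow> swap_product (block_exchange p q) i = (if i \<le> q then i + p else i - q)"
proof (induction q arbitrary: i)
  case 0
  then show ?case by (simp add: block_exchange_def swap_product_Nil)
next
  case (Suc q)
  have fix_outer: "swap_product (block_exchange p q) i = i" if "p + q < i" for i
    using that by (intro swap_product_fixes) (auto dest: set_block_exchange)
  have "swap_product (block_exchange p (Suc q)) i = swap_product (block_exchange p q)
      (if i = Suc q then Suc q + p else if Suc q < i \<and> i \<le> Suc q + p then i - 1 else i)"
    unfolding block_exchange_Suc swap_product_append comp_def swap_product_rev_interval ..
  moreover have "i - 1 \<in> {1..p + q}" "\<not> i - 1 \<le> q" if "\<not> i \<le> Suc q"
    using Suc.prems that by auto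
  ultimately show ?case
    using Suc.prems Suc.IH[of i] Suc.IH[of "i - 1"] by (cases "i \<le> Suc q") (auto simp: fix_outer)
qed

text \<open>As functions the last factor acts first: \<open>block_exchange\<close> carries
  \<open>i\<close> into the other block, whose own reversal then completes the value to
  \<open>p + q + 1 - i\<close>.\<close>

lemma shuffle_in_sorting_networks:
  assumes s: "s \<in> sorting_networks p" and t: "t \<in> sorting_networks q"
  shows "shuffle bs s (map ((+) p) t) @ block_exchange p q \<in> sorting_networks (p + q)"
  unfolding sorting_networks_def mem_Collect_eq
proof (intro conjI ballI)
  have "(p + q) choose 2 = (p choose 2) + (q choose 2) + p * q"
    by (induction q) (simp_all add: numeral_2_eq_2)
  then show "length (shuffle bs s (map ((+) p) t) @ block_exchange p q) = (p + q) choose 2"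
    using s t by (simp add: sorting_networks_def length_shuffle length_block_exchange)
next
  fix j assume "j \<in> set (shuffle bs s (map ((+) p) t) @ block_exchange p q)"
  then show "0 < j" "j < p + q"
    using s t by (auto simp: sorting_networks_def set_shuffle dest: set_block_exchange)
next
  fix i assume i: "i \<in> {1..p + q}"
  have prod: "swap_product (shuffle bs s (map ((+) p) t)) = swap_product s \<circ> swap_product (map ((+) p) t)"
    using s t by (intro swap_product_shuffle) (force simp: sorting_networks_def)
  have shift: "swap_product (map ((+) p) t) k = (if k \<le> p then k else p + swap_product t (k - p))" for k
    using t by (intro swap_product_shift) (auto simp: sorting_networks_def)
  have fix_s: "swap_product s k = k" if "p < k" for k
    using s that by (intro swap_product_fixes) (auto simp: sorting_networks_def)
  have sp: "swap_product s k = p + 1 - k" if "1 \<le> k" "k \<le> p" for k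
    using s that by (auto simp: sorting_networks_def)
  have tq: "swap_product t k = q + 1 - k" if "1 \<le> k" "k \<le> q" for k
    using t that by (auto simp: sorting_networks_def)
  show "swap_product (shuffle bs s (map ((+) p) t) @ block_exchange p q) i = p + q + 1 - i"
  proof (cases "i \<le> q")
    case True
    then show ?thesis
      using i by (simp add: swap_product_append prod swap_product_block_exchange shift fix_s tq)
  next
    case False
    then show ?thesis
      using i by (simp add: swap_product_append prod swap_product_block_exchange shift sp)
  qed
qed

text \<open>The networks \<open>s\<close> and \<open>t\<close> stay fixed and only the bits vary.
  Since \<open>p \<le> q\<close>, each of the \<open>p choose 2\<close> swaps of \<open>s\<close>
  has a partner in \<open>t\<close> to be ordered against.\<close>

lemma card_sorting_networks_ge:
  assumes "p \<le> q"
  shows "2 ^ (p choose 2) \<le> card (sorting_networks (p + q))"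
proof -
  obtain s t where s: "s \<in> sorting_networks p" and t: "t \<in> sorting_networks q"
    using sorting_networks_nonempty by blast
  define N where "N = p choose 2"
  define F where "F bs = shuffle bs s (map ((+) p) t) @ block_exchange p q" for bs
  have "N \<le> q choose 2" unfolding N_def choose_two using assms by (intro div_le_mono mult_le_mono) auto
  then have "inj_on F {bs. length bs = N}"
    using s t by (intro inj_onI, unfold F_def, intro shuffle_inject[of s "map ((+) p) t"])
      (auto simp: sorting_networks_def N_def)
  then have "card (F ` {bs. length bs = N}) = card {bs :: bool list. length bs = N}"
    by (rule card_image)
  also have "\<dots> = 2 ^ N" using card_lists_length_eq[of "UNIV :: bool set" N] by simp
  finally have "2 ^ N = card (F ` {bs. length bs = N})" by simp
  also have "\<dots> \<le> card (sorting_networks (p + q))"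
    using shuffle_in_sorting_networks[OF s t]
    by (intro card_mono finite_sorting_networks) (auto simp: F_def)
  finally show ?thesis by (simp add: N_def)
qed

section \<open>Slopes determine the generated network\<close>

lemma position_less_iff:
  assumes "finite Y" "q \<in> Y" "r \<in> Y"
  shows "position Y q < position Y r \<longleftrightarrow> fst q < fst r"
proof
  assume "fst q < fst r"
  then show "position Y q < position Y r"
    unfolding position_def using assms 
    by (intro psubset_card_mono psubsetI notI) (auto dest: equalityD2[THEN subsetD, of _ _ r])
next
  assume less: "position Y q < position Y r"
  show "fst q < fst r"
  proof (rule ccontr)
    assume "\<not> fst q < fst r"
    then have "position Y r \<le> position Y q"
      unfolding position_def using assms by (intro card_mono) auto
    then show False using less by simp
  qed
qed

lemma bij_betw_position:
  assumes "finite Y" "inj_on fst Y"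
  shows "bij_betw (position Y) Y {1..card Y}"
proof -
  have inj: "inj_on (position Y) Y"
    using assms position_less_iff[OF assms(1)]
    by (intro inj_onI) (metis inj_onD less_irrefl linorder_less_linear)
  moreover have "position Y ` Y \<subseteq> {1..card Y}"
  proof
    fix k assume "k \<in> position Y ` Y"
    then obtain p where p: "p \<in> Y" "k = position Y p" by blast
    have "card {p} \<le> position Y p" "position Y p \<le> card Y"
      unfolding position_def using assms(1) p(1) by (intro card_mono; auto)+
    then show "k \<in> {1..card Y}" using p by simp
  qed
  ultimately have "position Y ` Y = {1..card Y}"
    by (intro card_subset_eq) (auto simp: card_image)
  with inj show ?thesis by (simp add: bij_betw_def)
qed

lemma inj_rotation: "inj (rotation \<phi>)"
proof (rule inj_on_inverseI)
  fix p
  have "sin \<phi> * sin \<phi> + cos \<phi> * cos \<phi> = 1" using sin_cos_squared_add[of \<phi>] by (simp add: power2_eq_square)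
  then have "(fst p * cos \<phi> - snd p * sin \<phi>) * cos \<phi> + (fst p * sin \<phi> + snd p * cos \<phi>) * sin \<phi> = fst p"
    "(fst p * sin \<phi> + snd p * cos \<phi>) * cos \<phi> - (fst p * cos \<phi> - snd p * sin \<phi>) * sin \<phi> = snd p"
    by algebra+
  then show "rotation (- \<phi>) (rotation \<phi> p) = p" by (simp add: rotation_def prod_eq_iff)
qed

section \<open>Readings as inverse ranks\<close>

definition labelled_point :: "(real \<times> real) set \<Rightarrow> nat \<Rightarrow> real \<times> real" where
  "labelled_point X = inv_into X (position X)"

text \<open>Ranks are taken of labels rather than of points, so that those of two different point
  sets can be compared.\<close>

definition rotated_rank :: "(real \<times> real) set \<Rightarrow> real \<Rightarrow> nat \<Rightarrow> nat" where
  "rotated_rank X \<phi> a = card {b \<in> {1..card X}.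
     fst (rotation \<phi> (labelled_point X b)) \<le> fst (rotation \<phi> (labelled_point X a))}"

context
  fixes X :: "(real \<times> real) set"
  assumes X: "finite X" "inj_on fst X"
begin

lemma bij_betw_labelled_point: "bij_betw (labelled_point X) {1..card X} X"
  unfolding labelled_point_def by (intro bij_betw_inv_into bij_betw_position X)

lemma labelled_point_in: "a \<in> {1..card X} \<Longrightarrow> labelled_point X a \<in> X"
  using bij_betw_labelled_point by (auto simp: bij_betw_def)

lemma position_labelled_point: "a \<in> {1..card X} \<Longrightarrow> position X (labelled_point X a) = a"
  unfolding labelled_point_def by (rule bij_betw_inv_into_right[OF bij_betw_position[OF X]])

lemma labelled_point_less:
  assumes "a \<in> {1..card X}" "b \<in> {1..card X}" "a < b"
  shows "fst (labelled_point X a) < fst (labelled_point X b)"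
  using position_less_iff[OF X(1) labelled_point_in labelled_point_in, of a b] assms
  by (simp add: position_labelled_point)

text \<open>When the rotated first coordinates are distinct, the ranks permute the labels and
  \<open>reading\<close> is the inverse permutation. Later arguments use this instead of the
  definite description in \<open>reading\<close>.\<close>

lemma reading_rank:
  assumes \<phi>: "inj_on fst (rotation \<phi> ` X)" and i: "i \<in> {1..card X}"
  shows "reading X \<phi> i \<in> {1..card X}" (is ?in)
    and "rotated_rank X \<phi> (reading X \<phi> i) = i" (is ?rank)
    and "a \<in> {1..card X} \<Longrightarrow> rotated_rank X \<phi> a = i \<Longrightarrow> reading X \<phi> i = a"
proof -
  let ?r = "rotation \<phi>"
  have inj_r: "inj_on ?r X" using inj_rotation by (rule inj_on_subset) simp
  have card_r: "card (?r ` X) = card X" using inj_r by (rule card_image)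
  have bij: "bij_betw (position (?r ` X) \<circ> (?r \<circ> labelled_point X)) {1..card X} {1..card X}"
    using bij_betw_position[OF _ \<phi>] X(1) card_r inj_r
    by (intro bij_betw_trans[OF bij_betw_trans[OF bij_betw_labelled_point]])
      (auto simp: inj_on_imp_bij_betw)
  have rank: "position (?r ` X) (?r (labelled_point X a)) = rotated_rank X \<phi> a" for a
  proof -
    have image: "?r ` X = (?r \<circ> labelled_point X) ` {1..card X}"
      using bij_betw_imp_surj_on[OF bij_betw_labelled_point] by (simp flip: image_image add: comp_def)
    have set_eq: "{y \<in> ?r ` X. fst y \<le> fst (?r (labelled_point X a))} =
        (?r \<circ> labelled_point X) ` {b \<in> {1..card X}.
          fst (?r (labelled_point X b)) \<le> fst (?r (labelled_point X a))}"
      unfolding image by auto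
    have "inj_on (?r \<circ> labelled_point X) {1..card X}"
      using bij_betw_labelled_point inj_r by (auto simp: bij_betw_def intro: comp_inj_on)
    then have "inj_on (?r \<circ> labelled_point X) {b \<in> {1..card X}.
        fst (?r (labelled_point X b)) \<le> fst (?r (labelled_point X a))}"
      by (rule inj_on_subset) auto
    then show ?thesis unfolding position_def rotated_rank_def set_eq by (rule card_image)
  qed
  have bij_rank: "bij_betw (rotated_rank X \<phi>) {1..card X} {1..card X}"
    using bij unfolding comp_def rank .
  have reading_eq: "reading X \<phi> i = a" if a: "a \<in> {1..card X}" "rotated_rank X \<phi> a = i" for a
  proof -
    have "(THE p. p \<in> X \<and> position (?r ` X) (?r p) = i) = labelled_point X a"
    proof (rule the_equality)
      fix q assume q: "q \<in> X \<and> position (?r ` X) (?r q) = i"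
      then obtain b where b: "b \<in> {1..card X}" "q = labelled_point X b"
        using bij_betw_imp_surj_on[OF bij_betw_labelled_point] by blast
      then have "rotated_rank X \<phi> b = rotated_rank X \<phi> a" using q a rank by simp
      then have "b = a" using inj_onD[OF bij_betw_imp_inj_on[OF bij_rank]] a(1) b(1) by blast
      then show "q = labelled_point X a" using b by simp
    qed (use a labelled_point_in rank in auto)
    then show ?thesis using a(1) by (simp add: reading_def position_labelled_point)
  qed
  then show "a \<in> {1..card X} \<Longrightarrow> rotated_rank X \<phi> a = i \<Longrightarrow> reading X \<phi> i = a" .
  obtain a where "a \<in> {1..card X}" "rotated_rank X \<phi> a = i"
    using bij_betw_imp_surj_on[OF bij_rank] i by (metis imageE)
  then show ?in ?rank using reading_eq by auto
qed

end

section \<open>Slopes and swap angles\<close>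

definition slope :: "(real \<times> real) set \<Rightarrow> nat \<times> nat \<Rightarrow> real" where
  "slope X e = (snd (labelled_point X (snd e)) - snd (labelled_point X (fst e))) /
     (fst (labelled_point X (snd e)) - fst (labelled_point X (fst e)))"

text \<open>This is the arc cotangent of the slope. Rotation by \<phi> turns the horizontal gap
  \<open>dx\<close> of a pair into \<open>dx * cos \<phi> - dy * sin \<phi>\<close>, which vanishes
  strictly between 0 and \<open>pi\<close> exactly where \<open>cot \<phi>\<close> is the slope.
  Larger slopes therefore swap earlier.\<close>

definition swap_angle :: "(real \<times> real) set \<Rightarrow> nat \<times> nat \<Rightarrow> real" where
  "swap_angle X e = pi / 2 - arctan (slope X e)"

definition label_pairs :: "nat \<Rightarrow> (nat \<times> nat) set" where
  "label_pairs n = {(a, b). 1 \<le> a \<and> a < b \<and> b \<le> n}"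

lemma swap_angle_bounds: "0 < swap_angle X e" "swap_angle X e < pi"
  using arctan_ubound[of "slope X e"] arctan_lbound[of "slope X e"] by (simp_all add: swap_angle_def)

lemma swap_angle_le_iff: "swap_angle X e \<le> swap_angle X f \<longleftrightarrow> slope X f \<le> slope X e"
  by (simp add: swap_angle_def arctan_le_iff)

lemma finite_label_pairs: "finite (label_pairs n)"
  by (rule finite_subset[of _ "{1..n} \<times> {1..n}"]) (auto simp: label_pairs_def)

lemma slope_less_iff_cot:
  assumes "0 < \<phi>" "\<phi> < pi"
  shows "m < cot \<phi> \<longleftrightarrow> \<phi> < pi / 2 - arctan m" "m = cot \<phi> \<longleftrightarrow> \<phi> = pi / 2 - arctan m"
proof -
  have "arctan (cot \<phi>) = pi / 2 - \<phi>"
    using assms by (intro arctan_unique) (auto simp: tan_cot')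
  then show "m < cot \<phi> \<longleftrightarrow> \<phi> < pi / 2 - arctan m" "m = cot \<phi> \<longleftrightarrow> \<phi> = pi / 2 - arctan m"
    using arctan_less_iff[of m "cot \<phi>"] arctan_eq_iff[of m "cot \<phi>"] by auto
qed

context
  fixes X :: "(real \<times> real) set"
  assumes X: "finite X" "inj_on fst X"
begin

lemma rotated_less_iff:
  assumes e: "(a, b) \<in> label_pairs (card X)" and \<phi>: "0 < \<phi>" "\<phi> < pi"
  shows "fst (rotation \<phi> (labelled_point X a)) < fst (rotation \<phi> (labelled_point X b)) \<longleftrightarrow>
      \<phi> < swap_angle X (a, b)" (is ?less)
    and "fst (rotation \<phi> (labelled_point X a)) = fst (rotation \<phi> (labelled_point X b)) \<longleftrightarrow>
      \<phi> = swap_angle X (a, b)" (is ?eq)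
proof -
  let ?p = "labelled_point X a" and ?q = "labelled_point X b"
  have dx: "0 < fst ?q - fst ?p"
    using e labelled_point_less[OF X, of a b] by (auto simp: label_pairs_def)
  have sin: "0 < sin \<phi>" using \<phi> by (rule sin_gt_zero)
  have "fst (rotation \<phi> ?p) < fst (rotation \<phi> ?q) \<longleftrightarrow>
      (snd ?q - snd ?p) * sin \<phi> < cos \<phi> * (fst ?q - fst ?p)"
    by (simp add: rotation_def algebra_simps)
  also have "\<dots> \<longleftrightarrow> slope X (a, b) < cot \<phi>"
    using dx sin by (simp add: slope_def cot_def divide_less_eq less_divide_eq)
  also have "\<dots> \<longleftrightarrow> \<phi> < swap_angle X (a, b)"
    unfolding swap_angle_def using \<phi> by (rule slope_less_iff_cot)
  finally show ?less .
  have "fst (rotation \<phi> ?p) = fst (rotation \<phi> ?q) \<longleftrightarrow>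
      (snd ?q - snd ?p) * sin \<phi> = cos \<phi> * (fst ?q - fst ?p)"
    by (auto simp: rotation_def algebra_simps)
  also have "\<dots> \<longleftrightarrow> slope X (a, b) = cot \<phi>"
    using dx sin by (simp add: slope_def cot_def divide_eq_eq eq_divide_eq)
  also have "\<dots> \<longleftrightarrow> \<phi> = swap_angle X (a, b)"
    unfolding swap_angle_def using \<phi> by (rule slope_less_iff_cot)
  finally show ?eq .
qed

lemma swap_angles_eq: "swap_angles X = swap_angle X ` label_pairs (card X)"
proof (intro equalityI subsetI)
  fix \<phi> assume "\<phi> \<in> swap_angles X"
  then have \<phi>: "0 < \<phi>" "\<phi> < pi" "\<not> inj_on fst (rotation \<phi> ` X)" by (auto simp: swap_angles_def)
  then obtain p q where pq: "p \<in> X" "q \<in> X" "p \<noteq> q" "fst (rotation \<phi> p) = fst (rotation \<phi> q)"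
    by (auto simp: inj_on_def)
  obtain a b where ab: "a \<in> {1..card X}" "b \<in> {1..card X}" "p = labelled_point X a" "q = labelled_point X b"
    using pq bij_betw_imp_surj_on[OF bij_betw_labelled_point[OF X]] by (metis imageE)
  then have "a \<noteq> b" using pq by auto
  then consider "(a, b) \<in> label_pairs (card X)" | "(b, a) \<in> label_pairs (card X)"
    using ab by (force simp: label_pairs_def)
  then show "\<phi> \<in> swap_angle X ` label_pairs (card X)"
    using pq(4) ab \<phi> rotated_less_iff(2)[of a b \<phi>] rotated_less_iff(2)[of b a \<phi>]
    by cases auto
next
  fix \<phi> assume "\<phi> \<in> swap_angle X ` label_pairs (card X)"
  then obtain a b where ab: "(a, b) \<in> label_pairs (card X)" "\<phi> = swap_angle X (a, b)" by auto
  then have \<phi>: "0 < \<phi>" "\<phi> < pi" using swap_angle_bounds by auto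
  let ?p = "labelled_point X a" and ?q = "labelled_point X b"
  have labels: "a \<in> {1..card X}" "b \<in> {1..card X}" "a < b" using ab by (auto simp: label_pairs_def)
  have "fst (rotation \<phi> ?p) = fst (rotation \<phi> ?q)" using rotated_less_iff(2)[OF ab(1) \<phi>] ab(2) by simp
  moreover have "rotation \<phi> ?p \<noteq> rotation \<phi> ?q"
    using labelled_point_less[OF X labels] by (metis inj_eq[OF inj_rotation] less_irrefl)
  ultimately have "\<not> inj_on fst (rotation \<phi> ` X)"
    using labelled_point_in[OF X labels(1)] labelled_point_in[OF X labels(2)] by (meson imageI inj_onD)
  then show "\<phi> \<in> swap_angles X" using \<phi> by (simp add: swap_angles_def)
qed

text \<open>A pair is inverted exactly when its swap angle has been passed. Both orders of
  \<open>a\<close> and \<open>b\<close> are phrased through \<open>swap_angle < \<phi>\<close>, the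
  only information that \<open>reading_cong\<close> transfers.\<close>

lemma rotated_le_iff:
  assumes "a \<in> {1..card X}" "b \<in> {1..card X}" "0 < \<phi>" "\<phi> < pi" "\<phi> \<notin> swap_angles X"
  shows "fst (rotation \<phi> (labelled_point X b)) \<le> fst (rotation \<phi> (labelled_point X a)) \<longleftrightarrow>
    b = a \<or> b < a \<and> \<not> swap_angle X (b, a) < \<phi> \<or> a < b \<and> swap_angle X (a, b) < \<phi>"
proof (cases a b rule: linorder_cases)
  case less
  then have "(a, b) \<in> label_pairs (card X)" using assms by (auto simp: label_pairs_def)
  then show ?thesis using less assms rotated_less_iff[of a b \<phi>] swap_angles_eq by force
next
  case greater
  then have "(b, a) \<in> label_pairs (card X)" using assms by (auto simp: label_pairs_def)
  then show ?thesis using greater assms rotated_less_iff[of b a \<phi>] swap_angles_eq by force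
qed simp

end

lemma reading_cong:
  assumes X: "finite X" "inj_on fst X" and Y: "finite Y" "inj_on fst Y" and card: "card X = card Y"
    and \<phi>: "0 < \<phi>" "\<phi> < pi" "\<phi> \<notin> swap_angles X"
    and \<psi>: "0 < \<psi>" "\<psi> < pi" "\<psi> \<notin> swap_angles Y"
    and same: "\<And>e. e \<in> label_pairs (card X) \<Longrightarrow> swap_angle X e < \<phi> \<longleftrightarrow> swap_angle Y e < \<psi>"
    and i: "i \<in> {1..card X}"
  shows "reading X \<phi> i = reading Y \<psi> i"
proof -
  have inj: "inj_on fst (rotation \<phi> ` X)" "inj_on fst (rotation \<psi> ` Y)"
    using \<phi> \<psi> by (auto simp: swap_angles_def)
  have rank: "rotated_rank X \<phi> a = rotated_rank Y \<psi> a" if a: "a \<in> {1..card X}" for a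
  proof -
    have "fst (rotation \<phi> (labelled_point X b)) \<le> fst (rotation \<phi> (labelled_point X a)) \<longleftrightarrow>
        fst (rotation \<psi> (labelled_point Y b)) \<le> fst (rotation \<psi> (labelled_point Y a))"
      if b: "b \<in> {1..card X}" for b
    proof -
      have "swap_angle X (a, b) < \<phi> \<longleftrightarrow> swap_angle Y (a, b) < \<psi>" if "a < b"
        using same a b that by (auto simp: label_pairs_def)
      moreover have "swap_angle X (b, a) < \<phi> \<longleftrightarrow> swap_angle Y (b, a) < \<psi>" if "b < a"
        using same a b that by (auto simp: label_pairs_def)
      ultimately show ?thesis
        using rotated_le_iff[OF X a b \<phi>] rotated_le_iff[OF Y a[unfolded card] b[unfolded card] \<psi>]
        by blast
    qed
    then show ?thesis
      unfolding rotated_rank_def card[symmetric]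
      by (metis (mono_tags, lifting))
  qed
  have "reading X \<phi> i \<in> {1..card X}" "rotated_rank X \<phi> (reading X \<phi> i) = i"
    using reading_rank(1,2)[OF X inj(1) i] by simp_all
  then show ?thesis
    using reading_rank(3)[OF Y inj(2) i[unfolded card], of "reading X \<phi> i"] rank card by simp
qed

section \<open>The order of slopes determines the swaps\<close>

lemma affine_parallel_if_slopes_eq:
  fixes p q p' q' :: "real \<times> real"
  assumes "fst p \<noteq> fst q" "fst p' \<noteq> fst q'"
    and slopes: "(snd q - snd p) / (fst q - fst p) = (snd q' - snd p') / (fst q' - fst p')"
  shows "affine_parallel (affine hull {p, q}) (affine hull {p', q'})"
proof -
  \<comment> \<open>The ratio of the horizontal extents. Equal slopes make it the factor between the
    direction vectors, and it is nonzero, so the line parameter can be rescaled by it in both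
    directions.\<close>
  define t where "t = (fst q' - fst p') / (fst q - fst p)"
  have "t * (snd q - snd p) = (fst q' - fst p') * ((snd q - snd p) / (fst q - fst p))"
    by (simp add: t_def)
  also have "\<dots> = snd q' - snd p'" unfolding slopes using assms(2) by simp
  finally have t: "t \<noteq> 0" "q' - p' = t *\<^sub>R (q - p)"
    using assms(1,2) by (simp_all add: t_def prod_eq_iff)
  have "affine hull {p', q'} = (\<lambda>x. (p' - p) + x) ` (affine hull {p, q})"
    unfolding affine_hull_2_alt t(2)
  proof (intro equalityI image_subsetI; (elim rangeE)?)
    fix u :: real
    show "p' + u *\<^sub>R (t *\<^sub>R (q - p)) \<in> (+) (p' - p) ` range (\<lambda>u. p + u *\<^sub>R (q - p))"
      by (intro image_eqI[of _ _ "p + (u * t) *\<^sub>R (q - p)"]) auto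
  next
    fix x u assume "x = p + u *\<^sub>R (q - p)"
    then show "p' - p + x \<in> range (\<lambda>u. p' + u *\<^sub>R (t *\<^sub>R (q - p)))"
      using t(1) by (intro image_eqI[of _ _ "u / t"]) auto
  qed
  then show ?thesis unfolding affine_parallel_def by blast
qed

text \<open>Equal slopes of two different pairs would give parallel lines. As
  \<open>affine_parallel\<close> also holds for coinciding lines, this covers pairs with a common
  point.\<close>

lemma inj_on_slope:
  assumes "finite X" and gp: "general_position X"
  shows "inj_on (slope X) (label_pairs (card X))"
proof (rule inj_onI, rule ccontr)
  fix e f assume e: "e \<in> label_pairs (card X)" and f: "f \<in> label_pairs (card X)"
    and eq: "slope X e = slope X f" and "e \<noteq> f"
  obtain a b c d where ab: "e = (a, b)" and cd: "f = (c, d)" by (cases e, cases f)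
  have X: "finite X" "inj_on fst X" using assms by (simp_all add: general_position_def)
  let ?p = "labelled_point X"
  have labels: "a \<in> {1..card X}" "b \<in> {1..card X}" "a < b" "c \<in> {1..card X}" "d \<in> {1..card X}" "c < d"
    using e f by (auto simp: label_pairs_def ab cd)
  have fst_neq: "fst (?p a) \<noteq> fst (?p b)" "fst (?p c) \<noteq> fst (?p d)"
    using labelled_point_less[OF X labels(1-3)] labelled_point_less[OF X labels(4-6)] by simp_all
  have inj: "inj_on ?p {1..card X}" using bij_betw_labelled_point[OF X] by (rule bij_betw_imp_inj_on)
  have "{?p a, ?p b} \<noteq> {?p c, ?p d}"
    using labels \<open>e \<noteq> f\<close> by (auto simp: ab cd doubleton_eq_iff inj_on_eq_iff[OF inj])
  moreover have "affine_parallel (affine hull {?p a, ?p b}) (affine hull {?p c, ?p d})"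
    using eq fst_neq by (intro affine_parallel_if_slopes_eq) (simp_all add: slope_def ab cd)
  moreover have "?p a \<in> X" "?p b \<in> X" "?p c \<in> X" "?p d \<in> X"
    using labels by (simp_all add: labelled_point_in[OF X])
  moreover have "?p a \<noteq> ?p b" "?p c \<noteq> ?p d" using fst_neq by auto
  ultimately show False
    using gp unfolding general_position_def by blast
qed

text \<open>Larger slopes swap earlier and different pairs swap at different angles, so the number
  of slopes at least that of \<open>e\<close> is the index \<open>r\<close> with
  \<open>swap_angle X e = \<theta> r\<close>. The right-hand side mentions no angle and depends on
  the slope order alone.\<close>

lemma swap_angle_less_iff_card:
  assumes X: "finite X" "general_position X"
    and \<theta>: "strict_mono_on {0..N + 1} \<theta>" "swap_angles X = \<theta> ` {1..N}"
    and k: "k \<le> N" "\<alpha> \<in> {\<theta> k<..<\<theta> (k + 1)}" and e: "e \<in> label_pairs (card X)"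
  shows "swap_angle X e < \<alpha> \<longleftrightarrow> card {f \<in> label_pairs (card X). slope X e \<le> slope X f} \<le> k"
proof -
  have X': "inj_on fst X" using X by (simp add: general_position_def)
  have image: "swap_angle X ` label_pairs (card X) = \<theta> ` {1..N}"
    using swap_angles_eq[OF X(1) X'] \<theta>(2) by simp
  have less_iff: "\<theta> i < \<theta> j \<longleftrightarrow> i < j" if "i \<le> N + 1" "j \<le> N + 1" for i j
    using strict_mono_on_less[OF \<theta>(1)] that by simp
  have le_iff: "\<theta> i \<le> \<theta> j \<longleftrightarrow> i \<le> j" if "i \<le> N + 1" "j \<le> N + 1" for i j
    using less_iff[OF that(2,1)] by auto
  obtain r where r: "r \<in> {1..N}" "swap_angle X e = \<theta> r" using image e by blast
  have inj: "inj_on (swap_angle X) (label_pairs (card X))"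
    using inj_on_slope[OF X] by (auto simp: inj_on_def swap_angle_def arctan_eq_iff)
  have "card {f \<in> label_pairs (card X). slope X e \<le> slope X f} =
      card (swap_angle X ` {f \<in> label_pairs (card X). swap_angle X f \<le> swap_angle X e})"
    unfolding swap_angle_le_iff by (intro card_image[symmetric] inj_on_subset[OF inj]) auto
  also have "swap_angle X ` {f \<in> label_pairs (card X). swap_angle X f \<le> swap_angle X e} =
      {\<phi> \<in> swap_angle X ` label_pairs (card X). \<phi> \<le> \<theta> r}"
    unfolding r(2) by auto
  also have "\<dots> = \<theta> ` {1..r}" unfolding image using r(1) le_iff by auto
  also have "card \<dots> = r"
  proof -
    have "inj_on \<theta> {1..r}"
      using strict_mono_on_imp_inj_on[OF \<theta>(1)] by (rule inj_on_subset) (use r in auto)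
    then show ?thesis by (simp add: card_image)
  qed
  finally have card: "card {f \<in> label_pairs (card X). slope X e \<le> slope X f} = r" .
  have "\<theta> r < \<alpha> \<longleftrightarrow> r \<le> k"
  proof (cases "r \<le> k")
    case True
    then show ?thesis using k le_iff[of r k] r(1) by auto
  next
    case False
    then show ?thesis using k le_iff[of "k + 1" r] r(1) by auto
  qed
  then show ?thesis using card r(2) by simp
qed

text \<open>The swap angles of \<open>X\<close> and \<open>Y\<close> may differ, but equal slope
  orders give equal readings in corresponding gaps between them. The \<open>k\<close>-th swaps of
  \<open>s\<close> and \<open>t\<close> thus turn the same injective reading into the same
  reading.\<close>

lemma generates_unique:
  assumes X: "finite X" "general_position X" "generates X s"
    and Y: "finite Y" "general_position Y" "generates Y t"
    and card: "card X = card Y" and len: "length s = length t"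
    and s: "\<forall>j\<in>set s. 0 < j \<and> j < card X" and t: "\<forall>j\<in>set t. 0 < j \<and> j < card X"
    and same: "\<And>e f. e \<in> label_pairs (card X) \<Longrightarrow> f \<in> label_pairs (card X) \<Longrightarrow>
      slope X e \<le> slope X f \<longleftrightarrow> slope Y e \<le> slope Y f"
  shows "s = t"
proof (rule nth_equalityI[OF len])
  fix k assume k: "k < length s"
  let ?N = "length s"
  have X': "inj_on fst X" and Y': "inj_on fst Y" using X Y by (simp_all add: general_position_def)
  obtain \<theta> where \<theta>: "\<theta> 0 = 0" "\<theta> (?N + 1) = pi" "strict_mono_on {0..?N + 1} \<theta>"
      "swap_angles X = \<theta> ` {1..?N}"
    and swaps: "\<And>k \<alpha> \<beta> i. k < ?N \<Longrightarrow> \<alpha> \<in> {\<theta> k<..<\<theta> (k + 1)} \<Longrightarrow> \<beta> \<in> {\<theta> (k + 1)<..<\<theta> (k + 2)} \<Longrightarrow>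
      i \<in> {1..card X} \<Longrightarrow> reading X \<beta> i = reading X \<alpha> (adj_swap (s ! k) i)"
    using X(3) unfolding generates_def by (elim exE conjE) (rule that, assumption+, simp)
  obtain \<eta> where \<eta>: "\<eta> 0 = 0" "\<eta> (?N + 1) = pi" "strict_mono_on {0..?N + 1} \<eta>"
      "swap_angles Y = \<eta> ` {1..?N}"
    and swaps': "\<And>k \<alpha> \<beta> i. k < ?N \<Longrightarrow> \<alpha> \<in> {\<eta> k<..<\<eta> (k + 1)} \<Longrightarrow> \<beta> \<in> {\<eta> (k + 1)<..<\<eta> (k + 2)} \<Longrightarrow>
      i \<in> {1..card X} \<Longrightarrow> reading Y \<beta> i = reading Y \<alpha> (adj_swap (t ! k) i)"
    using Y(3) unfolding generates_def len[symmetric] card[symmetric]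
    by (elim exE conjE) (rule that, assumption+, simp)
  define mid where "mid \<theta> m = (\<theta> m + \<theta> (m + 1)) / 2" for \<theta> :: "nat \<Rightarrow> real" and m
  have mid: "mid \<theta> m \<in> {\<theta> m<..<\<theta> (m + 1)}" "0 < mid \<theta> m" "mid \<theta> m < pi" "mid \<theta> m \<notin> \<theta> ` {1..?N}"
    if \<theta>: "\<theta> 0 = 0" "\<theta> (?N + 1) = pi" "strict_mono_on {0..?N + 1} \<theta>" and m: "m \<le> ?N" for \<theta> m
  proof -
    have less: "\<theta> i < \<theta> j \<longleftrightarrow> i < j" if "i \<le> ?N + 1" "j \<le> ?N + 1" for i j
      using strict_mono_on_less[OF \<theta>(3)] that by simp
    show between: "mid \<theta> m \<in> {\<theta> m<..<\<theta> (m + 1)}" using less[of m "m + 1"] m by (simp add: mid_def)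
    have "\<theta> 0 \<le> \<theta> m" "\<theta> (m + 1) \<le> \<theta> (?N + 1)"
      using less[of m 0] less[of "?N + 1" "m + 1"] m by auto
    then show "0 < mid \<theta> m" "mid \<theta> m < pi" using between \<theta> by auto
    show "mid \<theta> m \<notin> \<theta> ` {1..?N}"
    proof
      assume "mid \<theta> m \<in> \<theta> ` {1..?N}"
      then obtain i where "i \<in> {1..?N}" "\<theta> m < \<theta> i" "\<theta> i < \<theta> (m + 1)" using between by auto
      then show False using less[of m i] less[of i "m + 1"] m by auto
    qed
  qed
  have readings: "reading X (mid \<theta> m) i = reading Y (mid \<eta> m) i" if m: "m \<le> ?N" and i: "i \<in> {1..card X}" for m i
  proof (rule reading_cong[OF X(1) X' Y(1) Y' card _ _ _ _ _ _ _ i])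
    show "swap_angle X e < mid \<theta> m \<longleftrightarrow> swap_angle Y e < mid \<eta> m" if e: "e \<in> label_pairs (card X)" for e
    proof -
      have "{f \<in> label_pairs (card X). slope X e \<le> slope X f} = {f \<in> label_pairs (card Y). slope Y e \<le> slope Y f}"
        using same[OF e] card by auto
      then show ?thesis
        using swap_angle_less_iff_card[OF X(1,2) \<theta>(3,4) m mid(1)[OF \<theta>(1-3) m] e]
          swap_angle_less_iff_card[OF Y(1,2) \<eta>(3,4) m mid(1)[OF \<eta>(1-3) m] e[unfolded card]]
        by simp
    qed
  qed (use mid[OF \<theta>(1-3) m] mid[OF \<eta>(1-3) m] \<theta>(4) \<eta>(4) in auto)
  \<comment> \<open>A test position: the swap of \<open>s\<close> brings to it the label from
    \<open>Suc ?i\<close>. The swap of \<open>t\<close> must do so too, and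
    \<open>adj_swap j i = Suc i\<close> forces \<open>j = i\<close>.\<close>
  let ?i = "s ! k"
  have sk: "0 < s ! k" "s ! k < card X" and tk: "0 < t ! k" "t ! k < card X"
    using s t k len by (auto simp: nth_mem)
  have adj: "adj_swap (s ! k) ?i = Suc ?i" "adj_swap (t ! k) ?i \<in> {1..card X}"
    using sk tk by (auto simp: adj_swap_def Transposition.transpose_def)
  have i: "?i \<in> {1..card X}" "Suc ?i \<in> {1..card X}" using sk by auto
  have Suc_k: "k + 1 \<le> ?N" "k \<le> ?N" using k by auto
  have "reading X (mid \<theta> k) (Suc ?i) = reading X (mid \<theta> (k + 1)) ?i"
    using swaps[OF k mid(1)[OF \<theta>(1-3) Suc_k(2)] _ i(1)] mid(1)[OF \<theta>(1-3) Suc_k(1)] adj(1) by simp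
  also have "\<dots> = reading Y (mid \<eta> (k + 1)) ?i" using readings[OF Suc_k(1) i(1)] .
  also have "\<dots> = reading Y (mid \<eta> k) (adj_swap (t ! k) ?i)"
    using swaps'[OF k mid(1)[OF \<eta>(1-3) Suc_k(2)] _ i(1)] mid(1)[OF \<eta>(1-3) Suc_k(1)] by simp
  also have "\<dots> = reading X (mid \<theta> k) (adj_swap (t ! k) ?i)"
    using readings[OF Suc_k(2) adj(2)] ..
  finally have eq: "reading X (mid \<theta> k) (Suc ?i) = reading X (mid \<theta> k) (adj_swap (t ! k) ?i)" .
  have "inj_on fst (rotation (mid \<theta> k) ` X)"
    using mid[OF \<theta>(1-3) Suc_k(2)] \<theta>(4) by (auto simp: swap_angles_def)
  then have "Suc ?i = adj_swap (t ! k) ?i"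
    using reading_rank(2)[OF X(1) X' _ i(2)] reading_rank(2)[OF X(1) X' _ adj(2)] eq by metis
  then show "s ! k = t ! k"
    by (auto simp: adj_swap_def Transposition.transpose_def split: if_splits)
qed

section \<open>Comparison of the counts\<close>

text \<open>The slope of \<open>(c, d)\<close> minus that of \<open>(a, b)\<close>, multiplied by
  both horizontal distances. These are positive for pairs of increasing labels, so the sign survives
  and the expression becomes quadratic. Label \<open>a\<close> has its coordinates at indices
  \<open>2 * a\<close> and \<open>2 * a + 1\<close>; label \<open>n\<close> reaches
  \<open>2 * n + 1\<close>, whence the \<open>2 * n + 2\<close> variables.\<close>

definition slope_comparison :: "(nat \<times> nat) \<times> (nat \<times> nat) \<Rightarrow> (nat \<Rightarrow> real) \<Rightarrow> real" where
  "slope_comparison = (\<lambda>((a, b), (c, d)) u.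
     (u (2 * d + 1) - u (2 * c + 1)) * (u (2 * b) - u (2 * a)) -
     (u (2 * b + 1) - u (2 * a + 1)) * (u (2 * d) - u (2 * c)))"

definition coordinates :: "(real \<times> real) set \<Rightarrow> nat \<Rightarrow> real" where
  "coordinates X i = (if even i then fst (labelled_point X (i div 2)) else snd (labelled_point X (i div 2)))"

lemma poly_fun_slope_comparison:
  assumes "e \<in> label_pairs n" "f \<in> label_pairs n"
  shows "poly_fun (2 * n + 2) 2 (slope_comparison (e, f))"
proof -
  obtain a b c d where ef: "e = (a, b)" "f = (c, d)" by (cases e, cases f)
  have "poly_fun (2 * n + 2) (1 + 1) (slope_comparison (e, f))"
    unfolding slope_comparison_def ef split using assms
    by (intro poly_fun_diff poly_fun_mult poly_fun_coord) (auto simp: label_pairs_def ef)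
  then show ?thesis by (simp only: one_add_one)
qed

lemma slope_comparison_pos_iff:
  assumes X: "finite X" "inj_on fst X" and e: "e \<in> label_pairs (card X)" and f: "f \<in> label_pairs (card X)"
  shows "0 < slope_comparison (e, f) (coordinates X) \<longleftrightarrow> slope X e < slope X f"
    and "slope_comparison (e, f) (coordinates X) = 0 \<longleftrightarrow> slope X e = slope X f"
proof -
  obtain a b c d where ef: "e = (a, b)" "f = (c, d)" by (cases e, cases f)
  let ?p = "labelled_point X"
  have "0 < fst (?p b) - fst (?p a)" "0 < fst (?p d) - fst (?p c)"
    using e f labelled_point_less[OF X, of a b] labelled_point_less[OF X, of c d]
    by (auto simp: label_pairs_def ef)
  then show "0 < slope_comparison (e, f) (coordinates X) \<longleftrightarrow> slope X e < slope X f"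
    and "slope_comparison (e, f) (coordinates X) = 0 \<longleftrightarrow> slope X e = slope X f"
    by (auto simp: slope_comparison_def coordinates_def slope_def ef frac_less_eq frac_eq_eq
        divide_less_eq less_divide_eq mult.commute)
qed

lemma card_label_pairs_le: "card (label_pairs n) \<le> n\<^sup>2"
proof -
  have "card (label_pairs n) \<le> card ({1..n} \<times> {1..n})"
    by (intro card_mono) (auto simp: label_pairs_def)
  then show ?thesis by (simp add: power2_eq_square)
qed

text \<open>One generating point set is picked for each network, and its coordinate vector serves as
  the sample point. Different networks have different slope orders by
  \<open>generates_unique\<close>, hence different sign patterns.\<close>

lemma card_geometrically_realizable_le:
  "card {s. geometrically_realizable n s} \<le> (4 * n ^ 4 + 1) ^ (2 * n + 2)"
proof -
  define R where "R = {s. geometrically_realizable n s}"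
  have finite_R: "finite R"
    by (rule finite_subset[OF _ finite_sorting_networks[of n]]) (auto simp: R_def geometrically_realizable_def)
  have "\<forall>s\<in>R. \<exists>X. finite X \<and> card X = n \<and> general_position X \<and> generates X s"
    by (auto simp: R_def geometrically_realizable_def)
  then obtain X where "\<forall>s\<in>R. finite (X s) \<and> card (X s) = n \<and> general_position (X s) \<and> generates (X s) s"
    by (rule bchoice[THEN exE])
  then have X: "finite (X s)" "card (X s) = n" "general_position (X s)" "generates (X s) s" if "s \<in> R" for s
    using that by blast+
  have X': "inj_on fst (X s)" if "s \<in> R" for s
    using X(3)[OF that] by (simp add: general_position_def)
  \<comment> \<open>On the diagonal the comparison vanishes identically; off it, general position
    makes all sample values nonzero.\<close>
  define J where "J = {(e, f). e \<in> label_pairs n \<and> f \<in> label_pairs n \<and> e \<noteq> f}"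
  have J_subset: "J \<subseteq> label_pairs n \<times> label_pairs n" by (auto simp: J_def)
  have finite_J: "finite J" using J_subset by (rule finite_subset) (simp add: finite_label_pairs)
  have "card J \<le> card (label_pairs n \<times> label_pairs n)"
    using J_subset by (intro card_mono) (auto simp: finite_label_pairs)
  also have "\<dots> \<le> n\<^sup>2 * n\<^sup>2"
    unfolding card_cartesian_product using card_label_pairs_le by (intro mult_le_mono)
  finally have card_J: "card J \<le> n ^ 4" by (simp flip: power_add)
  have separated: "\<exists>j\<in>J. (0 < slope_comparison j (coordinates (X s))) \<noteq> (0 < slope_comparison j (coordinates (X t)))"
    if st: "s \<in> R" "t \<in> R" "s \<noteq> t" for s t
  proof (rule ccontr)
    assume none: "\<not> ?thesis"
    have same: "slope (X s) e < slope (X s) f \<longleftrightarrow> slope (X t) e < slope (X t) f"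
      if "e \<in> label_pairs n" "f \<in> label_pairs n" for e f
    proof (cases "e = f")
      case False
      then have "(e, f) \<in> J" using that by (simp add: J_def)
      then show ?thesis
        using none that st slope_comparison_pos_iff(1)[of "X s" e f] slope_comparison_pos_iff(1)[of "X t" e f]
        by (auto simp: X X')
    qed simp
    have "s = t"
    proof (rule generates_unique)
      show "\<forall>j\<in>set s. 0 < j \<and> j < card (X s)" "\<forall>j\<in>set t. 0 < j \<and> j < card (X s)"
          "length s = length t"
        using st X(2) by (auto simp: R_def geometrically_realizable_def sorting_networks_def)
      show "slope (X s) e \<le> slope (X s) f \<longleftrightarrow> slope (X t) e \<le> slope (X t) f"
        if "e \<in> label_pairs (card (X s))" "f \<in> label_pairs (card (X s))" for e f
        using same[of f e] that st by (simp add: X not_less[symmetric])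
    qed (use st X in auto)
    then show False using st by simp
  qed
  have "card ((\<lambda>s. coordinates (X s)) ` R) \<le> (2 * (2 * card J) + 1) ^ (2 * n + 2)"
  proof (rule card_sign_patterns_le[of J _ _ 2 slope_comparison])
    show "poly_fun (2 * n + 2) 2 (slope_comparison j)" if "j \<in> J" for j
      using that poly_fun_slope_comparison[of "fst j" n "snd j"] by (auto simp: J_def)
    fix u j assume u: "u \<in> (\<lambda>s. coordinates (X s)) ` R" and "j \<in> J"
    obtain e f where j: "j = (e, f)" "e \<in> label_pairs n" "f \<in> label_pairs n" "e \<noteq> f"
      using \<open>j \<in> J\<close> by (cases j) (simp add: J_def)
    obtain s where "s \<in> R" "u = coordinates (X s)" using u by blast
    then show "slope_comparison j u \<noteq> 0"
      using j slope_comparison_pos_iff(2)[of "X s" e f] inj_onD[OF inj_on_slope[of "X s"], of e f]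
      by (auto simp: X X')
  qed (use finite_J finite_R separated in \<open>blast+\<close>)
  moreover have "inj_on (\<lambda>s. coordinates (X s)) R"
    using separated by (intro inj_onI) metis
  ultimately have "card R \<le> (2 * (2 * card J) + 1) ^ (2 * n + 2)" by (simp add: card_image)
  also have "\<dots> \<le> (4 * n ^ 4 + 1) ^ (2 * n + 2)" using card_J by (intro power_mono) auto
  finally show ?thesis unfolding R_def .
qed

lemma prob_geometrically_realizable_le:
  "measure_pmf.prob (pmf_of_set (sorting_networks n)) {s. geometrically_realizable n s} \<le>
     (4 * real n ^ 4 + 1) ^ (2 * n + 2) / 2 powr (real n * (real n - 4) / 8)"
proof -
  define p where "p = n div 2"
  have "n = p + (n - p)" "p \<le> n - p" by (auto simp: p_def)
  then have "2 ^ (p choose 2) \<le> card (sorting_networks n)"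
    using card_sorting_networks_ge[of p "n - p"] by simp
  then have "real (2 ^ (p choose 2)) \<le> card (sorting_networks n)" by (simp only: of_nat_le_iff)
  moreover have "real (2 ^ (p choose 2)) = 2 powr real (p choose 2)" by (simp add: powr_realpow)
  moreover have "2 powr (real n * (real n - 4) / 8) \<le> 2 powr real (p choose 2)"
  proof -
    have "real (p choose 2) = real p * (real p - 1) / 2"
      by (induction p) (simp_all add: numeral_2_eq_2 field_simps)
    \<comment> \<open>The odd case fixes the constant 4: there \<open>n * (n - 4)\<close> equals
      \<open>4 * p * (p - 1) - 3\<close>.\<close>
    moreover have "n = 2 * p \<or> n = 2 * p + 1" unfolding p_def by linarith
    then have "real n * (real n - 4) \<le> 4 * (real p * (real p - 1))"
      by (auto simp: algebra_simps)
    ultimately show ?thesis by simp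
  qed
  ultimately have lower: "2 powr (real n * (real n - 4) / 8) \<le> card (sorting_networks n)"
    by linarith
  have "real (card {s. geometrically_realizable n s}) \<le> real ((4 * n ^ 4 + 1) ^ (2 * n + 2))"
    using card_geometrically_realizable_le of_nat_mono by blast
  then have upper: "real (card {s. geometrically_realizable n s}) \<le> (4 * real n ^ 4 + 1) ^ (2 * n + 2)"
    by (simp only: of_nat_power of_nat_add of_nat_mult of_nat_numeral of_nat_1)
  have "sorting_networks n \<inter> {s. geometrically_realizable n s} = {s. geometrically_realizable n s}"
    by (auto simp: geometrically_realizable_def)
  then have "measure_pmf.prob (pmf_of_set (sorting_networks n)) {s. geometrically_realizable n s} =
      card {s. geometrically_realizable n s} / card (sorting_networks n)"
    by (simp add: measure_pmf_of_set sorting_networks_nonempty finite_sorting_networks)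
  also have "\<dots> \<le> (4 * real n ^ 4 + 1) ^ (2 * n + 2) / 2 powr (real n * (real n - 4) / 8)"
    using lower upper by (intro frac_le) auto
  finally show ?thesis .
qed

theorem theorem1p3:
  shows "(\<lambda>n. measure_pmf.prob (pmf_of_set (sorting_networks n)) {s. geometrically_realizable n s})
           \<longlonglongrightarrow> 0"
proof (rule tendsto_sandwich[OF _ _ tendsto_const])
  show "(\<lambda>n. (4 * real n ^ 4 + 1) ^ (2 * n + 2) / 2 powr (real n * (real n - 4) / 8)) \<longlonglongrightarrow> 0"
    by real_asymp
  show "\<forall>\<^sub>F n in sequentially.
      measure_pmf.prob (pmf_of_set (sorting_networks n)) {s. geometrically_realizable n s} \<le>
      (4 * real n ^ 4 + 1) ^ (2 * n + 2) / 2 powr (real n * (real n - 4) / 8)"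
    by (intro always_eventually allI prob_geometrically_realizable_le)
qed simp

end
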